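(* Let $q=2^t$ for a positive integer $t$. The rank over $\mathbb{F}_2$ of the incidence matrix $M(P_1,L_1)$ is $$1+\left(\frac{1+\sqrt{17}}{2}\right)^{2t}+\left(\frac{1-\sqrt{17}}{2}\right)^{2t}-2^{t+1}.$$
   Context: Let $q$ be a prime power and $V$ a $4$-dimensional vector space over $\mathbb{F}_q$ with a nonsingular alternating bilinear form $(\cdot,\cdot)$, and a symplectic basis $e_0,e_1,e_2,e_3$ with $(e_0,e_3)=(e_1,e_2)=1$ (and the other pairings of basis vectors zero apart from those forced by alternation). Write points of the projective space $P=P(V)$ (the set of $1$-dimensional subspaces of $V$) in homogeneous coordinates $(a:b:c:d)$ with respect to this basis. $L$ denotes the set of totally isotropic $2$-dimensional subspaces of $V$ ("lines"), with incidence given by containment; $(P,L)$ is the symplectic generalized quadrangle $W(q)$. Fix $p_0=\langle e_0\rangle$ and $\ell_0=\langle e_0,e_1\rangle$. Let $p_0^{\perp}=\{(a:b:c:0)\}$ be the set of points on lines through $p_0$, let $P_1=P\setminus p_0^{\perp}$ (the points with last coordinate nonzero), and let $L_1$ be the set of lines of $L$ having no point in common with $\ell_0$. $M(P_1,L_1)$ is the $0/1$ incidence matrix with rows indexed by $P_1$ and columns indexed by $L_1$. *)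

theory Defs
  imports Complex_Main "HOL-Library.Z2" "HOL-Library.Function_Algebras"
begin

text \<open>Vectors of V = F_q^4, written in coordinates w.r.t. the symplectic basis e0,e1,e2,e3.\<close>
type_synonym 'a vec4 = "'a \<times> 'a \<times> 'a \<times> 'a"

definition vsmult :: "'a::field \<Rightarrow> 'a vec4 \<Rightarrow> 'a vec4" where
  "vsmult c v = (case v of (a, b, d, e) \<Rightarrow> (c * a, c * b, c * d, c * e))"

definition vadd :: "'a::field vec4 \<Rightarrow> 'a vec4 \<Rightarrow> 'a vec4" where
  "vadd u v = (case u of (a, b, c, d) \<Rightarrow> case v of (a', b', c', d') \<Rightarrow>
      (a + a', b + b', c + c', d + d'))"

definition vzero :: "'a::field vec4" where "vzero = (0, 0, 0, 0)"

text \<open>Alternating form with (e0,e3) = (e1,e2) = 1.\<close>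
definition sform :: "'a::field vec4 \<Rightarrow> 'a vec4 \<Rightarrow> 'a" where
  "sform u v = (case u of (a, b, c, d) \<Rightarrow> case v of (a', b', c', d') \<Rightarrow>
      a * d' - d * a' + b * c' - c * b')"

definition span1 :: "'a::field vec4 \<Rightarrow> 'a vec4 set" where
  "span1 v = {vsmult c v | c. True}"

definition span2 :: "'a::field vec4 \<Rightarrow> 'a vec4 \<Rightarrow> 'a vec4 set" where
  "span2 u w = {vadd (vsmult a u) (vsmult b w) | a b. True}"

definition lin_indep2 :: "'a::field vec4 \<Rightarrow> 'a vec4 \<Rightarrow> bool" where
  "lin_indep2 u w \<longleftrightarrow> (\<forall>a b. vadd (vsmult a u) (vsmult b w) = vzero \<longrightarrow> a = 0 \<and> b = 0)"

definition W_points :: "'a::field vec4 set set" where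
  "W_points = {span1 v | v. v \<noteq> vzero}"

text \<open>Lines: totally isotropic 2-dimensional subspaces (a 2-space spanned by u, w is totally
  isotropic iff (u,w) = 0, the form being alternating).\<close>
definition W_lines :: "'a::field vec4 set set" where
  "W_lines = {span2 u w | u w. lin_indep2 u w \<and> sform u w = 0}"

definition e0 :: "'a::field vec4" where "e0 = (1, 0, 0, 0)"
definition e1 :: "'a::field vec4" where "e1 = (0, 1, 0, 0)"

definition ell0 :: "'a::field vec4 set" where "ell0 = span2 e0 e1"

definition P1 :: "'a::field vec4 set set" where
  "P1 = {p \<in> W_points. \<exists>a b c d. (a, b, c, d) \<in> p \<and> d \<noteq> 0}"

definition L1 :: "'a::field vec4 set set" where
  "L1 = {l \<in> W_lines. \<not> (\<exists>p \<in> W_points. p \<subseteq> l \<and> p \<subseteq> ell0)}"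

text \<open>Row of M(P_1,L_1) indexed by the point p, as an F_2-valued function on lines
  (zero outside the column index set L_1).\<close>
definition inc_row :: "'a::field vec4 set \<Rightarrow> ('a vec4 set \<Rightarrow> bit)" where
  "inc_row p = (\<lambda>l. if l \<in> L1 \<and> p \<subseteq> l then 1 else 0)"

definition rank_F2_M :: "'a::field itself \<Rightarrow> nat" where
  "rank_F2_M _ = vector_space.dim (\<lambda>(c::bit) f. (\<lambda>x. c * f x))
      (inc_row ` (P1 :: 'a vec4 set set))"

end

theory Submission
  imports Defs "HOL-Library.FuncSet"
begin

text \<open>
  In suitable coordinates the points are \<open>(a, b, c)\<close>, the lines are \<open>(x, y, z)\<close>, and incidence means
  \<open>b = a x + y\<close> and \<open>c = a y + z\<close>. The rank over the prime field equals the dimension over \<open>F_q\<close> of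
  the space \<open>C\<close> of functions spanned by the indicator functions of the lines.

  Upper bound: with the affine forms \<open>u = b + a x + y\<close> and \<open>v = c + a y + z\<close> the indicator function of
  a line is \<open>1 + u ^ (q - 1) + v ^ (q - 1) + (u v) ^ (q - 1)\<close>. Writing \<open>(u v) ^ (q - 1)\<close> as the product
  of the \<open>(u v) ^ (2 ^ i)\<close> and carrying squares to the next factor, one expands it into words with \<open>t\<close>
  cyclically arranged digits that are accepted by a two-state automaton. Its transition matrix has
  eigenvalues \<open>((1 + sqrt 17) / 2)\<^sup>2\<close> and \<open>((1 - sqrt 17) / 2)\<^sup>2\<close>. Exactly \<open>2 ^ t\<close> words are counted
  twice, and \<open>q - 1\<close> linear functionals that vanish on \<open>C\<close> are independent on the span of the words.

  Lower bound: \<open>C\<close> is filtered so that its associated graded space contains the subalgebra, generated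
  by all \<open>b_i\<close>, \<open>c_i\<close> and \<open>theta_i = a_i b_i + a_(i+1) c_i\<close>, of the algebra of square-free polynomials in
  \<open>a_i, b_i, c_i\<close> (\<open>i\<close> modulo \<open>t\<close>). An automaton with the same transition matrix describes leading
  monomials of this subalgebra.
\<close>

section \<open>Finite fields of even order\<close>

text \<open>No explicit basis of the code is produced in the upper bound: a word such as
  \<open>word2 cc cb l\<close> with \<open>l \<noteq> {}\<close> does not lie in the code, and
  independence of the words is never shown directly. Two counts are made to meet instead. In both
  automata 5 letters keep state \<open>False\<close>, 4 keep state \<open>True\<close>, 1 leads from
  \<open>False\<close> to \<open>True\<close> and 4 lead back; cyclic runs are counted by the trace
  of the \<open>t\<close>-th power of this matrix. From it \<open>2 ^ t\<close> is subtracted for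
  words that run in both states, and \<open>2 ^ t - 1\<close> for a deficit of the runs that start
  in state \<open>True\<close>. In the upper bound the deficit comes from pairs of perpendicular
  hyperbolic lines, which in characteristic 2 are met by the same lines; in the lower bound it comes
  from cyclic words in which no letter forces the state, so that the reading has nowhere to begin.
  The filtration exists because reduction by \<open>x ^ q = x\<close> turns multiplication of
  monomials into cyclic addition of binary exponents, in which every collision of digits loses at
  least one digit. Products without carry are therefore the leading terms.\<close>

interpretation fv: vector_space "\<lambda>(c::'k::field) (f::'b \<Rightarrow> 'k) x. c * f x"
  by unfold_locales (auto simp: plus_fun_def algebra_simps)

lemma sum_fun_apply: "(\<Sum>i\<in>I. f i) x = (\<Sum>i\<in>I. f i x)"
  for f :: "'i \<Rightarrow> 'b \<Rightarrow> 'c::comm_monoid_add"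
  by (induction I rule: infinite_finite_induct) (auto simp: zero_fun_def plus_fun_def)

lemma prod_fun_apply: "(\<Prod>i\<in>I. f i) x = (\<Prod>i\<in>I. f i x)"
  for f :: "'i \<Rightarrow> 'b \<Rightarrow> 'c::comm_monoid_mult"
  by (induction I rule: infinite_finite_induct) (auto simp: one_fun_def times_fun_def)

locale char2_field =
  fixes t :: nat and F :: "'a::{finite, field} itself"
  assumes t_pos: "t > 0" and card_field: "card (UNIV :: 'a set) = 2 ^ t"
begin

section \<open>Characteristic two, Frobenius and reduced monomials\<close>

lemma two_eq_zero: "(2::'a) = 0"
proof -
  have "(\<Sum>y\<in>UNIV. y + 1) = (\<Sum>y\<in>(UNIV::'a set). y)"
    by (rule sum.reindex_bij_witness[where i = "\<lambda>y. y - 1" and j = "\<lambda>y. y + 1"]) auto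
  hence "of_nat (card (UNIV :: 'a set)) = (0::'a)"
    by (simp add: sum.distrib)
  hence "(2::'a) ^ t = 0" by (simp add: card_field)
  thus ?thesis by simp
qed

lemma add_self: "x + x = (0::'a)"
  using two_eq_zero by (metis mult_2 mult_zero_left)

lemma uminus_eq: "- x = (x::'a)"
  using add_self minus_unique by blast

lemma diff_eq_add: "x - y = x + (y::'a)"
  using uminus_eq by (metis diff_conv_add_uminus)

lemma add_eq_0: "x + y = 0 \<longleftrightarrow> x = (y::'a)"
  by (metis add_self diff_eq_add right_minus_eq)

lemma add_pow2: "(x + y) ^ (2 ^ i) = x ^ (2 ^ i) + (y::'a) ^ (2 ^ i)"
proof (induction i)
  case (Suc i)
  have "(x + y) ^ (2 ^ Suc i) = (x ^ (2 ^ i) + y ^ (2 ^ i)) ^ 2"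
    by (simp only: power_Suc2 power_mult Suc)
  also have "\<dots> = (x ^ (2 ^ i)) ^ 2 + (y ^ (2 ^ i)) ^ 2"
    using two_eq_zero by (simp add: power2_sum)
  finally show ?case by (simp only: power_Suc2 power_mult)
qed simp

lemma power_card_minus_1: assumes "x \<noteq> (0::'a)" shows "x ^ (2 ^ t - 1) = 1"
proof -
  let ?U = "UNIV - {0::'a}"
  have "(\<Prod>y\<in>?U. x * y) = (\<Prod>y\<in>?U. y)"
    using assms
    by (intro prod.reindex_bij_witness[where i = "\<lambda>y. y / x" and j = "\<lambda>y. x * y"]) auto
  moreover have "(\<Prod>y\<in>?U. x * y) = x ^ (2 ^ t - 1) * (\<Prod>y\<in>?U. y)"
    by (simp add: prod.distrib card_field card_Diff_singleton)
  moreover have "(\<Prod>y\<in>?U. y) \<noteq> 0" by simp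
  ultimately show ?thesis by simp
qed

lemma card_minus_1_pos: "2 ^ t - (1::nat) > 0"
  using t_pos one_less_power[of "2::nat" t] by simp

lemma power_card_minus_1_eq: "x ^ (2 ^ t - 1) = (if x = 0 then 0 else (1::'a))"
  using power_card_minus_1 card_minus_1_pos by auto

lemma power_card: "x ^ (2 ^ t) = (x::'a)"
proof (cases "x = 0")
  case False
  have "x ^ (2 ^ t) = x * x ^ (2 ^ t - 1)"
    by (metis power_Suc Suc_pred' zero_less_power pos2 One_nat_def)
  thus ?thesis using power_card_minus_1[OF False] by simp
qed simp

text \<open>The set \<open>r\<close> holds the binary digits of the exponent; subsets of
  \<open>{..<t}\<close> encode the exponents from 0 to q - 1. Since \<open>x ^ (2 ^ i)\<close> is
  additive in \<open>x\<close>, the binomial expansion \<open>Xm_add\<close> is a plain sum over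
  subsets, which is Lucas' theorem modulo 2.\<close>

definition Xm :: "nat set \<Rightarrow> 'a \<Rightarrow> 'a" where "Xm r x = (\<Prod>i\<in>r. x ^ (2 ^ i))"

lemma Xm_empty[simp]: "Xm {} x = 1" by (simp add: Xm_def)

lemma Xm_mult: "Xm r (x * y) = Xm r x * Xm r y"
  by (simp add: Xm_def power_mult_distrib prod.distrib)

lemma Xm_Un_disjoint: "finite r \<Longrightarrow> finite s \<Longrightarrow> r \<inter> s = {} \<Longrightarrow> Xm (r \<union> s) x = Xm r x * Xm s x"
  by (simp add: Xm_def prod.union_disjoint)

lemma Xm_add: "finite u \<Longrightarrow> Xm u (x + y) = (\<Sum>r\<in>Pow u. Xm r x * Xm (u - r) y)"
  by (simp add: Xm_def add_pow2 prod_add)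

lemma Xm_full: "Xm {..<t} x = x ^ (2 ^ t - 1)"
proof -
  have "(\<Sum>i<t. 2 ^ i) = (2::nat) ^ t - 1" by (simp add: lessThan_atLeast0 sum_power2)
  thus ?thesis by (simp add: Xm_def power_sum[symmetric])
qed

lemma Xm_zero: "finite r \<Longrightarrow> Xm r 0 = (if r = {} then 1 else 0)"
  by (auto simp: Xm_def)

text \<open>Weights of the dual basis: summing \<open>chi r x * f x\<close> over the field gives the
  coefficient of \<open>Xm r\<close> in \<open>f\<close>. The extra 1 for \<open>r = {}\<close> is
  the constant term of the indicator \<open>1 + (x + y) ^ (q - 1)\<close> of
  \<open>x = y\<close>.\<close>

definition chi :: "nat set \<Rightarrow> 'a \<Rightarrow> 'a" where
  "chi r x = Xm ({..<t} - r) x + (if r = {} then 1 else 0)"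

lemma delta_expand:
  "(if x = y then 1 else 0) = (\<Sum>r\<in>Pow {..<t}. chi r x * Xm r y)"
proof -
  have "(\<Sum>r\<in>Pow {..<t}. chi r x * Xm r y) =
      (\<Sum>r\<in>Pow {..<t}. Xm r y * Xm ({..<t} - r) x) + (\<Sum>r\<in>Pow {..<t}. if r = {} then Xm r y else 0)"
    unfolding sum.distrib[symmetric] by (intro sum.cong refl) (auto simp: chi_def algebra_simps)
  also have "(\<Sum>r\<in>Pow {..<t}. if r = {} then Xm r y else 0) = 1"
    by (subst sum.delta) auto
  also have "(\<Sum>r\<in>Pow {..<t}. Xm r y * Xm ({..<t} - r) x) = (y + x) ^ (2 ^ t - 1)"
    by (simp only: Xm_full[symmetric] Xm_add finite_lessThan)
  finally show ?thesis
    unfolding power_card_minus_1_eq add_eq_0 using add_self[of 1] by auto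
qed

lemma Xm_expand: "f y = (\<Sum>r\<in>Pow {..<t}. (\<Sum>x\<in>UNIV. chi r x * f x) * Xm r y)"
proof -
  have "f y = (\<Sum>x\<in>UNIV. f x * (if x = y then 1 else 0))"
    by (simp add: if_distrib cong: if_cong)
  also have "\<dots> = (\<Sum>x\<in>UNIV. \<Sum>r\<in>Pow {..<t}. chi r x * f x * Xm r y)"
    by (simp only: delta_expand sum_distrib_left) (simp add: mult_ac)
  also have "\<dots> = (\<Sum>r\<in>Pow {..<t}. \<Sum>x\<in>UNIV. chi r x * f x * Xm r y)"
    by (rule sum.swap)
  finally show ?thesis by (simp add: sum_distrib_right)
qed

text \<open>The expansion map onto the functions is injective because both sides have \<open>q ^ q\<close> elements.\<close>

lemma chi_Xm:
  assumes "r \<subseteq> {..<t}" "r' \<subseteq> {..<t}"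
  shows "(\<Sum>x\<in>UNIV. chi r x * Xm r' x) = (if r = r' then 1 else 0)"
proof -
  let ?P = "Pow {..<t}"
  let ?A = "?P \<rightarrow>\<^sub>E (UNIV :: 'a set)"
  define E where "E = (\<lambda>c y. \<Sum>r\<in>?P. c r * Xm r y)"
  have surj: "E ` ?A = UNIV"
  proof (intro equalityI subsetI UNIV_I)
    fix f :: "'a \<Rightarrow> 'a"
    let ?c = "restrict (\<lambda>r. \<Sum>x\<in>UNIV. chi r x * f x) ?P"
    have "f = E ?c"
      unfolding E_def by (rule ext, subst Xm_expand) (auto intro!: sum.cong)
    moreover have "?c \<in> ?A" by auto
    ultimately show "f \<in> E ` ?A" by blast
  qed
  have "(UNIV \<rightarrow>\<^sub>E UNIV) = (UNIV :: ('a \<Rightarrow> 'a) set)" by (auto simp: PiE_def extensional_def)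
  moreover have "card (UNIV \<rightarrow>\<^sub>E UNIV :: ('a \<Rightarrow> 'a) set) = (2 ^ t) ^ 2 ^ t"
    by (subst card_PiE) (auto simp: card_field)
  ultimately have "card ?A = card (E ` ?A)"
    unfolding surj by (simp add: card_PiE card_field card_Pow)
  moreover have "finite ?A" by (intro finite_PiE) auto
  ultimately have inj: "inj_on E ?A" by (metis eq_card_imp_inj_on)
  let ?c = "restrict (\<lambda>r. \<Sum>x\<in>UNIV. chi r x * Xm r' x) ?P"
  let ?d = "restrict (\<lambda>r. if r = r' then 1 else (0::'a)) ?P"
  have 1: "E ?c = Xm r'"
    unfolding E_def by (rule ext, subst (2) Xm_expand) (auto intro!: sum.cong)
  have 2: "E ?d = Xm r'"
  proof
    fix y
    have "E ?d y = (\<Sum>r\<in>?P. if r = r' then Xm r y else 0)"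
      unfolding E_def by (intro sum.cong refl) auto
    thus "E ?d y = Xm r' y" using assms by simp
  qed
  have "?c = ?d" by (rule inj_onD[OF inj]) (simp_all add: 1 2)
  hence "?c r = ?d r" by simp
  thus ?thesis using assms by simp
qed

section \<open>Cyclic carries in products of reduced monomials\<close>

definition sig :: "nat \<Rightarrow> nat" where "sig i = (i + 1) mod t"

lemma sig_less: "sig i < t" using t_pos by (simp add: sig_def)

lemma inj_on_sig: "inj_on sig {..<t}"
proof (rule inj_onI)
  fix i j assume "i \<in> {..<t}" "j \<in> {..<t}" "sig i = sig j"
  thus "i = j"
    by (cases "i + 1 = t"; cases "j + 1 = t") (auto simp: sig_def)
qed

lemma pow2_sig: assumes "i < t" shows "(x::'a) ^ (2 ^ Suc i) = x ^ (2 ^ sig i)"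
  using assms power_card[of x] by (cases "Suc i = t") (auto simp: sig_def)

lemma Xm_square: assumes "r \<subseteq> {..<t}" shows "Xm r (x ^ 2) = Xm (sig ` r) x"
proof -
  have "Xm (sig ` r) x = (\<Prod>i\<in>r. x ^ (2 ^ sig i))"
    unfolding Xm_def by (subst prod.reindex) (auto intro: inj_on_subset[OF inj_on_sig assms])
  also have "\<dots> = (\<Prod>i\<in>r. (x ^ 2) ^ (2 ^ i))"
    using assms pow2_sig[of _ x] by (intro prod.cong refl) (auto simp: power_mult[symmetric])
  finally show ?thesis by (simp add: Xm_def)
qed

text \<open>Adding \<open>2 ^ i\<close> to an exponent whose digit \<open>i\<close> is set removes
  this digit and adds the next power of two, cyclically because \<open>x ^ q = x\<close>. The digit
  set shrinks before each further carry, hence the induction on its cardinality.\<close>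

lemma Xm_times_single:
  assumes "r \<subseteq> {..<t}" "i < t"
  shows "\<exists>u\<subseteq>{..<t}. (\<forall>x. Xm r x * x ^ (2 ^ i) = Xm u x) \<and> card u \<le> Suc (card r) \<and>
           (i \<notin> r \<longrightarrow> u = insert i r) \<and> (i \<in> r \<longrightarrow> card u \<le> card r)"
  using assms
proof (induction "card r" arbitrary: r i rule: less_induct)
  case less
  have fin: "finite r" using less.prems finite_subset by blast
  show ?case
  proof (cases "i \<in> r")
    case False
    have "Xm r x * x ^ (2 ^ i) = Xm (insert i r) x" for x
      using False fin by (simp add: Xm_def mult.commute)
    thus ?thesis using False fin less.prems by (intro exI[of _ "insert i r"]) auto
  next
    case True
    let ?r = "r - {i}"
    have c: "card ?r < card r" "Suc (card ?r) = card r" using True fin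
      by (simp_all add: card_gt_0_iff card_Suc_Diff1 card_Diff1_less del: card_Diff_insert card_Diff_singleton)
    obtain u where u: "u \<subseteq> {..<t}" "\<And>x. Xm ?r x * x ^ (2 ^ sig i) = Xm u x" "card u \<le> Suc (card ?r)"
      using less.hyps[of ?r "sig i"] c less.prems sig_less by blast
    have "Xm r x * x ^ (2 ^ i) = Xm u x" for x
    proof -
      have "Xm r x = x ^ (2 ^ i) * Xm ?r x"
        using True fin by (simp add: Xm_def prod.remove)
      hence "Xm r x * x ^ (2 ^ i) = Xm ?r x * x ^ (2 ^ Suc i)"
        by (simp add: power_mult power2_eq_square mult_ac power_add[symmetric] mult_2)
      thus ?thesis using u(2) pow2_sig[OF less.prems(2), of x] by simp
    qed
    thus ?thesis using True u c by (intro exI[of _ u]) auto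
  qed
qed

lemma Xm_times_ex:
  assumes "r \<subseteq> {..<t}" "s \<subseteq> {..<t}"
  shows "\<exists>u\<subseteq>{..<t}. (\<forall>x. Xm r x * Xm s x = Xm u x) \<and> card u \<le> card r + card s \<and>
           (r \<inter> s = {} \<longrightarrow> u = r \<union> s) \<and> (r \<inter> s \<noteq> {} \<longrightarrow> card u < card r + card s)"
proof -
  have "finite s" using assms finite_subset by blast
  thus ?thesis using assms(2)
  proof (induction s rule: finite_induct)
    case empty
    thus ?case using assms by (intro exI[of _ r]) auto
  next
    case (insert i s)
    then obtain u where u: "u \<subseteq> {..<t}" "\<And>x. Xm r x * Xm s x = Xm u x" "card u \<le> card r + card s"
      "r \<inter> s = {} \<longrightarrow> u = r \<union> s" "r \<inter> s \<noteq> {} \<longrightarrow> card u < card r + card s" by auto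
    obtain w where w: "w \<subseteq> {..<t}" "\<And>x. Xm u x * x ^ (2 ^ i) = Xm w x" "card w \<le> Suc (card u)"
      "i \<notin> u \<longrightarrow> w = insert i u" "i \<in> u \<longrightarrow> card w \<le> card u"
      using Xm_times_single[OF u(1), of i] insert.prems by auto
    have "Xm r x * Xm (insert i s) x = Xm w x" for x
    proof -
      have "Xm (insert i s) x = Xm s x * x ^ (2 ^ i)"
        using insert.hyps by (simp add: Xm_def mult.commute)
      thus ?thesis by (metis u(2) w(2) mult.assoc)
    qed
    thus ?case using u w insert.hyps
      by (intro exI[of _ w]) (cases "r \<inter> s = {}"; cases "i \<in> r"; auto)
  qed
qed

definition mu :: "nat set \<Rightarrow> nat set \<Rightarrow> nat set" where
  "mu r s = (SOME u. u \<subseteq> {..<t} \<and> (\<forall>x. Xm r x * Xm s x = Xm u x) \<and> card u \<le> card r + card s \<and>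
           (r \<inter> s = {} \<longrightarrow> u = r \<union> s) \<and> (r \<inter> s \<noteq> {} \<longrightarrow> card u < card r + card s))"

lemma mu:
  assumes "r \<subseteq> {..<t}" "s \<subseteq> {..<t}"
  shows mu_subset: "mu r s \<subseteq> {..<t}" and Xm_times: "Xm r x * Xm s x = Xm (mu r s) x"
    and card_mu_le: "card (mu r s) \<le> card r + card s"
    and mu_disjoint: "r \<inter> s = {} \<Longrightarrow> mu r s = r \<union> s"
    and card_mu_less: "r \<inter> s \<noteq> {} \<Longrightarrow> card (mu r s) < card r + card s"
  using someI_ex[OF Xm_times_ex[OF assms]] unfolding mu_def by blast+

end

section \<open>Reduction to the code of lines of LU(3, q)\<close>

context char2_field
begin

section \<open>The trace and functionals over the prime field\<close>

definition trace :: "'a \<Rightarrow> 'a" where "trace x = (\<Sum>i<t. x ^ (2 ^ i))"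

lemma trace_add: "trace (x + y) = trace x + trace y"
  by (simp add: trace_def add_pow2 sum.distrib)

lemma square_sum: "(\<Sum>i\<in>I. f i) ^ 2 = (\<Sum>i\<in>I. (f i :: 'a) ^ 2)"
  using add_pow2[of _ _ 1] by (induction I rule: infinite_finite_induct) auto

lemma sig_image: "sig ` {..<t} = {..<t}"
  using inj_on_sig sig_less by (intro endo_inj_surj) auto

lemma trace_square: "trace x ^ 2 = trace x"
proof -
  have "trace x ^ 2 = (\<Sum>i<t. x ^ (2 ^ sig i))"
    unfolding trace_def square_sum using pow2_sig[of _ x]
    by (intro sum.cong refl) (auto simp: power_mult mult.commute[of 2] simp flip: power_mult)
  also have "\<dots> = (\<Sum>i\<in>sig ` {..<t}. x ^ (2 ^ i))"
    by (simp add: sum.reindex[OF inj_on_sig])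
  finally show ?thesis by (simp only: sig_image trace_def)
qed

lemma trace_01: "trace x = 0 \<or> trace x = 1"
proof -
  have "trace x * (trace x - 1) = 0"
    using trace_square[of x] by (simp add: algebra_simps power2_eq_square)
  thus ?thesis by auto
qed

text \<open>The trace is a polynomial in which \<open>x\<close> has coefficient 1, and
  \<open>chi {0}\<close> reads off this coefficient; it would be 0 if the trace vanished
  everywhere.\<close>

lemma trace_nonzero: "\<exists>x. trace x = 1"
proof (rule ccontr)
  assume "\<nexists>x. trace x = 1"
  hence "(\<Sum>x\<in>UNIV. chi {0} x * trace x) = 0" using trace_01 by (auto intro!: sum.neutral)
  moreover have "(\<Sum>x\<in>UNIV. chi {0} x * trace x) = (\<Sum>x\<in>UNIV. \<Sum>i<t. chi {0} x * Xm {i} x)"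
    by (simp add: trace_def Xm_def sum_distrib_left)
  also have "\<dots> = (\<Sum>i<t. \<Sum>x\<in>UNIV. chi {0} x * Xm {i} x)" by (rule sum.swap)
  also have "\<dots> = (\<Sum>i<t. if i = 0 then 1 else 0)"
    using t_pos by (intro sum.cong refl) (auto simp: chi_Xm)
  also have "\<dots> = 1" using t_pos by simp
  finally show False using zero_neq_one by metis
qed

text \<open>The trace of a suitable multiple. Such a functional turns a linear relation over F_q
  between 0/1 vectors into one over F_2 without losing the chosen coefficient
  \<open>c\<close>.\<close>

lemma additive_functional:
  assumes "c \<noteq> (0::'a)"
  obtains h :: "'a \<Rightarrow> bit" where "\<And>x y. h (x + y) = h x + h y" "h c = 1"
proof -
  obtain y where y: "trace y = 1" using trace_nonzero by blast
  let ?h = "\<lambda>x. if trace (y / c * x) = 0 then 0 else 1 :: bit"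
  have "?h (u + v) = ?h u + ?h v" for u v
  proof -
    have "trace (y / c * (u + v)) = trace (y / c * u) + trace (y / c * v)"
      by (simp only: distrib_left trace_add)
    thus ?thesis
      using trace_01[of "y / c * u"] trace_01[of "y / c * v"] add_self[of 1] by fastforce
  qed
  moreover have "?h c = 1" using assms y by simp
  ultimately show thesis by (rule that)
qed

definition emb :: "bit \<Rightarrow> 'a" where "emb b = (if b = 0 then 0 else 1)"

lemma emb_simps[simp]: "emb 0 = 0" "emb 1 = 1" by (simp_all add: emb_def)

lemma emb_add: "emb (x + y) = emb x + emb y"
  using add_self[of 1] by (cases x; cases y) simp_all

lemma emb_mult: "emb (x * y) = emb x * emb y"
  by (cases x; cases y) simp_all

lemma emb_sum: "emb (\<Sum>i\<in>I. f i) = (\<Sum>i\<in>I. emb (f i))"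
proof (induction I rule: infinite_finite_induct)
  case (insert i I)
  thus ?case by (simp only: sum.insert emb_add not_False_eq_True)
qed simp_all

text \<open>In the coordinates \<open>p = \<langle>(c, b, a, 1)\<rangle>\<close> and \<open>l = \<langle>(y, x, 1, 0), (z, y, 0, 1)\<rangle>\<close> the
  incidence structure becomes that of \<open>LU(3, q)\<close>.\<close>

definition Pt :: "'a \<times> 'a \<times> 'a \<Rightarrow> 'a vec4 set" where
  "Pt = (\<lambda>(a, b, c). span1 (c, b, a, 1))"

definition Ln :: "'a \<times> 'a \<times> 'a \<Rightarrow> 'a vec4 set" where
  "Ln = (\<lambda>(x, y, z). span2 (y, x, 1, 0) (z, y, 0, 1))"

definition line_fun :: "'a \<times> 'a \<times> 'a \<Rightarrow> 'a \<times> 'a \<times> 'a \<Rightarrow> 'a" where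
  "line_fun = (\<lambda>(x, y, z) (a, b, c). if b = a * x + y \<and> c = a * y + z then 1 else 0)"

lemma mem_Ln: "(u1, u2, u3, u4) \<in> Ln (x, y, z) \<longleftrightarrow> u1 = u3 * y + u4 * z \<and> u2 = u3 * x + u4 * y"
  by (auto simp: Ln_def span2_def vadd_def vsmult_def)

lemma Pt_subset_Ln: "Pt (a, b, c) \<subseteq> Ln (x, y, z) \<longleftrightarrow> b = a * x + y \<and> c = a * y + z"
proof
  assume *: "Pt (a, b, c) \<subseteq> Ln (x, y, z)"
  have "(c, b, a, 1) \<in> Pt (a, b, c)"
    unfolding Pt_def span1_def by (auto simp: vsmult_def intro!: exI[of _ 1])
  with * have "(c, b, a, 1) \<in> Ln (x, y, z)" by blast
  thus "b = a * x + y \<and> c = a * y + z" by (simp add: mem_Ln)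
next
  assume "b = a * x + y \<and> c = a * y + z"
  thus "Pt (a, b, c) \<subseteq> Ln (x, y, z)"
    by (auto simp: Pt_def span1_def vsmult_def mem_Ln algebra_simps)
qed

lemma P1_eq: "P1 = range Pt"
proof (intro equalityI subsetI)
  fix p :: "'a vec4 set" assume "p \<in> P1"
  then obtain v a b c d where v: "p = span1 v" "(a, b, c, d) \<in> p" "d \<noteq> 0"
    unfolding P1_def W_points_def by blast
  obtain v1 v2 v3 v4 where [simp]: "v = (v1, v2, v3, v4)" by (cases v)
  have v4: "v4 \<noteq> 0" using v by (auto simp: span1_def vsmult_def)
  have "span1 v = span1 (v1 / v4, v2 / v4, v3 / v4, 1)"
  proof (intro equalityI subsetI)
    fix u assume "u \<in> span1 v"
    then obtain k where "u = vsmult k v" by (auto simp: span1_def)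
    hence "u = vsmult (k * v4) (v1 / v4, v2 / v4, v3 / v4, 1)" using v4 by (simp add: vsmult_def)
    thus "u \<in> span1 (v1 / v4, v2 / v4, v3 / v4, 1)" unfolding span1_def by blast
  next
    fix u assume "u \<in> span1 (v1 / v4, v2 / v4, v3 / v4, 1)"
    then obtain k where "u = vsmult k (v1 / v4, v2 / v4, v3 / v4, 1)" by (auto simp: span1_def)
    hence "u = vsmult (k / v4) v" using v4 by (simp add: vsmult_def)
    thus "u \<in> span1 v" unfolding span1_def by blast
  qed
  thus "p \<in> range Pt" using v by (auto simp: Pt_def image_iff intro: exI[of _ "v3 / v4"])
next
  fix p assume "p \<in> range Pt"
  then obtain a b c where p: "p = span1 (c, b, a, 1)" by (auto simp: Pt_def)
  moreover have "(c, b, a, 1) \<in> span1 (c, b, a, 1)"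
    unfolding span1_def by (auto simp: vsmult_def intro!: exI[of _ 1])
  moreover have "(c, b, a, 1) \<noteq> (vzero :: 'a vec4)" by (simp add: vzero_def)
  ultimately have "p \<in> W_points" "\<exists>a b c d. (a, b, c, d) \<in> p \<and> d \<noteq> 0"
    unfolding W_points_def by (blast, metis zero_neq_one)
  thus "p \<in> P1" unfolding P1_def by simp
qed

lemma mem_ell0: "(u1, u2, u3, u4) \<in> ell0 \<longleftrightarrow> u3 = 0 \<and> u4 = (0::'a)"
  by (auto simp: ell0_def span2_def vadd_def vsmult_def e0_def e1_def)

lemma span1_subset_iff: 
  assumes "S = span2 u w" shows "span1 v \<subseteq> S \<longleftrightarrow> v \<in> (S :: 'a vec4 set)"
proof
  have "v \<in> span1 v" unfolding span1_def by (cases v) (auto simp: vsmult_def intro!: exI[of _ 1])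
  thus "span1 v \<subseteq> S \<Longrightarrow> v \<in> S" by blast
next
  assume "v \<in> S"
  then obtain a b where v: "v = vadd (vsmult a u) (vsmult b w)" unfolding assms span2_def by blast
  have "vsmult k v = vadd (vsmult (k * a) u) (vsmult (k * b) w)" for k
    unfolding v by (cases u; cases w) (simp add: vsmult_def vadd_def algebra_simps)
  thus "span1 v \<subseteq> S" unfolding span1_def assms span2_def by blast
qed

lemma L1_eq: "L1 = range Ln"
proof (intro equalityI subsetI)
  fix l :: "'a vec4 set" assume l: "l \<in> L1"
  then obtain u w where uw: "l = span2 u w" "lin_indep2 u w" "sform u w = 0"
    unfolding L1_def W_lines_def by blast
  have nopt: "v = vzero" if "v \<in> l" "v \<in> ell0" for v
  proof (rule ccontr)
    assume "v \<noteq> vzero"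
    hence "span1 v \<in> W_points" unfolding W_points_def by blast
    moreover have "span1 v \<subseteq> l" "span1 v \<subseteq> ell0"
      using that span1_subset_iff[OF uw(1)] span1_subset_iff[OF ell0_def] by auto
    ultimately show False using l unfolding L1_def by blast
  qed
  obtain u1 u2 u3 u4 where u: "u = (u1, u2, u3, u4)" by (cases u)
  obtain w1 w2 w3 w4 where w: "w = (w1, w2, w3, w4)" by (cases w)
  \<comment> \<open>A Pluecker coordinate. As the line misses \<open>ell0\<close>, its projection to
    the last two coordinates is injective, so \<open>D \<noteq> 0\<close>, and Cramer's rule yields
    a basis that is the identity there.\<close>
  define D where "D = u3 * w4 - u4 * w3"
  have mem: "vadd (vsmult a u) (vsmult b w) \<in> l" for a b
    unfolding uw span2_def by blast
  have zero: "a = 0 \<and> b = 0" if "a * u3 + b * w3 = 0" "a * u4 + b * w4 = 0" for a b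
  proof -
    have "vadd (vsmult a u) (vsmult b w) \<in> ell0"
      using that by (simp add: u w vadd_def vsmult_def mem_ell0)
    hence "vadd (vsmult a u) (vsmult b w) = vzero" using nopt mem by blast
    thus ?thesis using uw(2) unfolding lin_indep2_def by blast
  qed
  have D: "D \<noteq> 0"
  proof
    assume D0: "D = 0"
    have "w4 = 0 \<and> - u4 = 0"
      by (rule zero) (use D0 in \<open>simp_all add: D_def algebra_simps\<close>)
    moreover have "w3 = 0 \<and> - u3 = 0"
      by (rule zero) (use D0 in \<open>simp_all add: D_def algebra_simps\<close>)
    ultimately have "(1::'a) = 0 \<and> (1::'a) = 0" by (intro zero) auto
    thus False by simp
  qed
  define x y z where "x = (w4 * u2 - u4 * w2) / D" and "y = (u3 * w2 - w3 * u2) / D"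
    and "z = (u3 * w1 - w3 * u1) / D"
  \<comment> \<open>The number \<open>y\<close> occurs in both basis vectors of
    \<open>Ln (x, y, z)\<close>; its two Cramer quotients agree because the line is totally
    isotropic.\<close>
  have y': "y = (w4 * u1 - u4 * w1) / D"
    using uw(3) D by (simp add: y_def u w sform_def algebra_simps)
  have div: "R = P * (m / D) + Q * (n / D)"
    if "P * m + Q * n = R * D" for P Q R m n
    using D that by (simp add: add_divide_distrib[symmetric])
  have "l = Ln (x, y, z)"
  proof (intro equalityI subsetI)
    fix v assume "v \<in> l"
    then obtain a b where v: "v = vadd (vsmult a u) (vsmult b w)" unfolding uw span2_def by blast
    have "(a * u3 + b * w3) * (w4 * u1 - u4 * w1) + (a * u4 + b * w4) * (u3 * w1 - w3 * u1) = (a * u1 + b * w1) * D"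
      "(a * u3 + b * w3) * (w4 * u2 - u4 * w2) + (a * u4 + b * w4) * (u3 * w2 - w3 * u2) = (a * u2 + b * w2) * D"
      by (simp_all add: D_def algebra_simps)
    hence "a * u1 + b * w1 = (a * u3 + b * w3) * y + (a * u4 + b * w4) * z"
      "a * u2 + b * w2 = (a * u3 + b * w3) * x + (a * u4 + b * w4) * y"
      unfolding y' z_def x_def using y' y_def div by metis+
    thus "v \<in> Ln (x, y, z)" unfolding v by (simp add: u w vadd_def vsmult_def mem_Ln)
  next
    fix v assume v: "v \<in> Ln (x, y, z)"
    obtain v1 v2 v3 v4 where [simp]: "v = (v1, v2, v3, v4)" by (cases v)
    define a b where "a = (v3 * w4 - v4 * w3) / D" and "b = (u3 * v4 - u4 * v3) / D"
    have 1: "v1 = v3 * ((w4 * u1 - u4 * w1) / D) + v4 * z" "v2 = v3 * x + v4 * y"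
      using v by (simp_all add: mem_Ln y')
    have "v1 = a * u1 + b * w1" "v2 = a * u2 + b * w2"
      unfolding 1 a_def b_def x_def y_def z_def times_divide_eq_left times_divide_eq_right
        add_divide_distrib[symmetric] by (simp_all add: algebra_simps)
    moreover have "(v3 * w4 - v4 * w3) * u3 + (u3 * v4 - u4 * v3) * w3 = v3 * D"
       "(v3 * w4 - v4 * w3) * u4 + (u3 * v4 - u4 * v3) * w4 = v4 * D"
      by (simp_all add: D_def algebra_simps)
    hence "v3 = a * u3 + b * w3" "v4 = a * u4 + b * w4"
      unfolding a_def b_def times_divide_eq_left add_divide_distrib[symmetric] using D by simp_all
    ultimately have "v = vadd (vsmult a u) (vsmult b w)" by (simp add: u w vadd_def vsmult_def)
    thus "v \<in> l" using mem by simp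
  qed
  thus "l \<in> range Ln" by blast
next
  fix l assume "l \<in> range Ln"
  then obtain x y z where l: "l = Ln (x, y, z)" by auto
  have "lin_indep2 (y, x, 1, 0) (z, y, 0, 1)" "sform (y, x, 1, 0) (z, y, 0, 1) = 0"
    by (auto simp: lin_indep2_def sform_def vadd_def vsmult_def vzero_def)
  hence "l \<in> W_lines" unfolding l Ln_def W_lines_def prod.case by blast
  moreover have False if "v \<noteq> vzero" "span1 v \<subseteq> l" "span1 v \<subseteq> ell0" for v
  proof -
    have "v \<in> l" "v \<in> ell0"
      using that span1_subset_iff[of l] span1_subset_iff[OF ell0_def] unfolding l Ln_def by auto
    thus False using that(1) by (cases v) (auto simp: l mem_Ln mem_ell0 vzero_def)
  qed
  ultimately show "l \<in> L1" unfolding L1_def W_points_def by blast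
qed

lemma inc_row_Ln: "emb (inc_row (Pt p) (Ln l)) = line_fun l p"
  by (cases p; cases l) (simp add: inc_row_def L1_eq Pt_subset_Ln line_fun_def)

section \<open>The rank over F_2 as a dimension over F_q\<close>

lemma rank_eq_dim: "rank_F2_M F = fv.dim (range (\<lambda>p::'a \<times> 'a \<times> 'a. inc_row (Pt p)))"
  unfolding rank_F2_M_def P1_eq by (simp add: image_image)

lemma span_finite_choice:
  assumes "finite W" "\<And>l. f l \<in> fv.span W"
  shows "\<exists>Q. \<forall>l. f l = (\<Sum>w\<in>W. (\<lambda>x. Q l w * w x))"
proof (intro choice allI)
  show "\<exists>q. f l = (\<Sum>w\<in>W. (\<lambda>x. q w * w x))" for l
    using assms(2)[of l] by (auto simp: fv.span_finite[OF assms(1)])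
qed

text \<open>Rank factorisation: the rows are combinations of an F_2-basis of the row space; read by
  columns, this writes every column, embedded in F_q, as a combination of equally many functions
  \<open>G e\<close>.\<close>

lemma rank_ge:
  assumes B: "B \<subseteq> fv.span (range line_fun)" "fv.independent B"
  shows "card B \<le> rank_F2_M F"
proof -
  let ?R = "range (\<lambda>p. inc_row (Pt p))"
  obtain Bs where Bs: "Bs \<subseteq> ?R" "fv.independent Bs" "?R \<subseteq> fv.span Bs" "card Bs = fv.dim ?R"
    by (rule fv.basis_exists)
  have fin: "finite Bs" by (rule finite_subset[OF Bs(1)]) simp
  have "inc_row (Pt p) \<in> fv.span Bs" for p using Bs(3) by auto
  from span_finite_choice[where f = "\<lambda>p. inc_row (Pt p)", OF fin this]
  obtain g where "\<forall>p. inc_row (Pt p) = (\<Sum>e\<in>Bs. (\<lambda>x. g p e * e x))" by (rule exE)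
  note g = this[rule_format]
  define G where "G = (\<lambda>e p. emb (g p e))"
  have "line_fun l \<in> fv.span (G ` Bs)" for l
  proof -
    have "line_fun l = (\<Sum>e\<in>Bs. (\<lambda>p. emb (e (Ln l)) * G e p))"
      by (rule ext) (simp only: inc_row_Ln[symmetric] g sum_fun_apply emb_sum emb_mult G_def mult.commute)
    also have "\<dots> \<in> fv.span (G ` Bs)"
      by (intro fv.span_sum fv.span_scale fv.span_base) auto
    finally show ?thesis .
  qed
  hence "fv.span (range line_fun) \<subseteq> fv.span (G ` Bs)"
    by (intro fv.span_minimal fv.subspace_span) auto
  hence "card B \<le> card (G ` Bs)"
    using fv.independent_span_bound[of "G ` Bs" B] B fin by auto
  also have "\<dots> \<le> card Bs" by (rule card_image_le[OF fin])
  finally show ?thesis using Bs(4) by (simp add: rank_eq_dim)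
qed

text \<open>The transposed factorisation bounds the dimension of the F_q-span of the embedded rows
  by \<open>card W\<close>. It remains to see that rows independent over F_2 stay independent over
  F_q: an additive functional that is 1 at a nonzero coefficient would carry a relation down to
  F_2.\<close>

lemma rank_le:
  assumes W: "finite W" "range line_fun \<subseteq> fv.span W"
  shows "rank_F2_M F \<le> card W"
proof -
  let ?R = "range (\<lambda>p. inc_row (Pt p))"
  obtain Bs where Bs: "Bs \<subseteq> ?R" "fv.independent Bs" "?R \<subseteq> fv.span Bs" "card Bs = fv.dim ?R"
    by (rule fv.basis_exists)
  have fin: "finite Bs" by (rule finite_subset[OF Bs(1)]) simp
  define R where "R = (\<lambda>(e :: 'a vec4 set \<Rightarrow> bit) l. emb (e (Ln l)))"
  have supp: "e l = 0" if "e \<in> Bs" "l \<notin> L1" for e l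
    using that Bs(1) by (auto simp: inc_row_def)
  have "line_fun l \<in> fv.span W" for l using W(2) by auto
  from span_finite_choice[where f = line_fun, OF W(1) this]
  obtain Q where "\<forall>l. line_fun l = (\<Sum>w\<in>W. (\<lambda>x. Q l w * w x))" by (rule exE)
  note Q = this[rule_format]
  have sub: "R ` Bs \<subseteq> fv.span ((\<lambda>w l. Q l w) ` W)"
  proof
    fix f assume "f \<in> R ` Bs"
    then obtain p where f: "f = R (inc_row (Pt p))" using Bs(1) by auto
    have "f = (\<Sum>w\<in>W. (\<lambda>l. w p * Q l w))"
      by (rule ext) (simp add: f R_def inc_row_Ln Q sum_fun_apply mult.commute)
    also have "\<dots> \<in> fv.span ((\<lambda>w l. Q l w) ` W)"
      by (intro fv.span_sum fv.span_scale fv.span_base) auto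
    finally show "f \<in> fv.span ((\<lambda>w l. Q l w) ` W)" .
  qed
  have indep: "u e0 = 0" if "e0 \<in> Bs" "\<And>l. (\<Sum>e\<in>Bs. u e * R e l) = 0" for u e0
  proof (rule ccontr)
    assume "u e0 \<noteq> 0"
    then obtain h :: "'a \<Rightarrow> bit" where h: "\<And>x y. h (x + y) = h x + h y" "h (u e0) = 1"
      using additive_functional by blast
    have h0: "h 0 = 0" using h(1)[of 0 0] by simp
    have hsum: "h (\<Sum>i\<in>I. f i) = (\<Sum>i\<in>I. h (f i))" for I :: "('a vec4 set \<Rightarrow> bit) set" and f
      by (induction I rule: infinite_finite_induct) (simp_all add: h h0)
    have hemb: "h (x * emb b) = h x * b" for x b by (cases b) (simp_all add: h0)
    have "(\<Sum>e\<in>Bs. (\<lambda>x. h (u e) * e x)) = 0"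
    proof
      fix l
      show "(\<Sum>e\<in>Bs. (\<lambda>x. h (u e) * e x)) l = 0 l"
      proof (cases "l \<in> L1")
        case True
        then obtain m where m: "l = Ln m" by (auto simp: L1_eq)
        have "(\<Sum>e\<in>Bs. h (u e) * e l) = h (\<Sum>e\<in>Bs. u e * R e m)"
          by (simp add: hsum R_def hemb m)
        also have "\<dots> = 0" by (simp add: that(2) h0)
        finally show ?thesis by (simp add: sum_fun_apply zero_fun_def)
      qed (simp add: sum_fun_apply supp)
    qed
    hence "h (u e0) = 0" using that(1)
      by (rule fv.independentD[where u = "\<lambda>e. h (u e)", OF Bs(2) fin subset_refl])
    thus False using h(2) by simp
  qed
  have inj: "inj_on R Bs"
  proof (rule inj_onI)
    fix e e' assume *: "e \<in> Bs" "e' \<in> Bs" "R e = R e'"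
    have "e (Ln m) = e' (Ln m)" for m
      using fun_cong[OF *(3), of m] by (auto simp: R_def emb_def split: if_splits)
    thus "e = e'" using supp * by (metis (no_types, lifting) L1_eq ext rangeE)
  qed
  have "fv.independent (R ` Bs)"
  proof (rule fv.independent_if_scalars_zero)
    fix u f assume *: "(\<Sum>x\<in>R ` Bs. (\<lambda>xa. u x * x xa)) = 0" "f \<in> R ` Bs"
    have "(\<Sum>e\<in>Bs. u (R e) * R e l) = 0" for l
      using fun_cong[OF *(1), of l] by (simp add: sum.reindex[OF inj] sum_fun_apply)
    thus "u f = 0" using indep[of _ "\<lambda>e. u (R e)"] *(2) by blast
  qed (use fin in simp)
  hence "card (R ` Bs) \<le> card ((\<lambda>w l. Q l w) ` W)"
    using fv.independent_span_bound[OF _ _ sub] W(1) by blast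
  also have "\<dots> \<le> card W" by (rule card_image_le[OF W(1)])
  finally show ?thesis using Bs(4) by (simp add: rank_eq_dim card_image[OF inj])
qed

end

section \<open>Words and carries\<close>

fun paths :: "nat \<Rightarrow> bool \<Rightarrow> bool \<Rightarrow> nat" where
  "paths 0 s s' = of_bool (s = s')"
| "paths (Suc n) s False = 5 * paths n s False + 4 * paths n s True"
| "paths (Suc n) s True = paths n s False + 4 * paths n s True"

text \<open>Cayley-Hamilton: the transition matrix has trace 9 and determinant 16, hence eigenvalues
  \<open>(9 + sqrt 17) / 2\<close> and \<open>(9 - sqrt 17) / 2\<close>.\<close>

lemma paths_recurrence: "paths (Suc (Suc n)) s s' + 16 * paths n s s' = 9 * paths (Suc n) s s'"
  by (cases s') simp_all

lemma paths_trace: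
  "real (paths n False False + paths n True True) =
    ((1 + sqrt 17) / 2) ^ (2 * n) + ((1 - sqrt 17) / 2) ^ (2 * n)"
proof -
  define tr where "tr n = real (paths n False False + paths n True True)" for n
  have rec: "tr (Suc (Suc n)) = 9 * tr (Suc n) - 16 * tr n" for n
    using paths_recurrence[of n False False] paths_recurrence[of n True True] by (simp add: tr_def)
  have eq: "tr n = ((9 + sqrt 17) / 2) ^ n + ((9 - sqrt 17) / 2) ^ n" for n
  proof (induction n rule: induct_nat_012)
    case (ge2 n)
    define u v where "u = (9 + sqrt 17) / 2" and "v = (9 - sqrt 17) / 2"
    have "u ^ 2 = 9 * u - 16" "v ^ 2 = 9 * v - 16"
      by (simp_all add: u_def v_def power2_eq_square field_simps)
    moreover have "w ^ Suc (Suc n) = 9 * w ^ Suc n - 16 * w ^ n" if "w ^ 2 = 9 * w - 16" for w :: real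
    proof -
      have "w ^ Suc (Suc n) = w ^ 2 * w ^ n" by (simp add: power2_eq_square)
      thus ?thesis unfolding that by (simp add: algebra_simps)
    qed
    ultimately have "u ^ Suc (Suc n) = 9 * u ^ Suc n - 16 * u ^ n" "v ^ Suc (Suc n) = 9 * v ^ Suc n - 16 * v ^ n"
      by blast+
    with ge2[folded u_def v_def] rec[of n] have "tr (Suc (Suc n)) = u ^ Suc (Suc n) + v ^ Suc (Suc n)"
      by linarith
    thus ?case by (simp only: u_def v_def)
  qed (simp_all add: tr_def field_simps)
  have "((1 + sqrt 17) / 2) ^ 2 = (9 + sqrt 17) / 2" "((1 - sqrt 17) / 2) ^ 2 = (9 - sqrt 17) / 2"
    by (simp_all add: power2_eq_square field_simps)
  thus ?thesis using eq[of n] by (simp only: tr_def power_mult)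
qed

context char2_field
begin

section \<open>Frobenius twists and products of spans\<close>

definition frob :: "nat \<Rightarrow> ('b \<Rightarrow> 'a) \<Rightarrow> 'b \<Rightarrow> 'a" where "frob n f = (\<lambda>p. f p ^ (2 ^ n))"

lemma frob_add: "frob n (f + g) = frob n f + frob n g"
  by (simp add: frob_def fun_eq_iff add_pow2)

lemma frob_mult: "frob n (f * g) = frob n f * frob n g"
  by (simp add: frob_def fun_eq_iff power_mult_distrib)

lemma frob_scale: "frob n (\<lambda>p. c * f p) = (\<lambda>p. c ^ (2 ^ n) * frob n f p)"
  by (simp add: frob_def fun_eq_iff power_mult_distrib)

lemma frob_0[simp]: "frob 0 f = f" by (simp add: frob_def)

lemma frob_one[simp]: "frob n 1 = 1" by (simp add: frob_def fun_eq_iff)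

lemma frob_card: "frob t f = f" by (simp add: frob_def power_card)

lemma frob_square: "frob n (f * f) = frob (Suc n) f"
  by (simp add: frob_def fun_eq_iff power_mult_distrib mult_2 power_add)

text \<open>The scalar \<open>d\<close> may differ from \<open>c\<close>, so that semilinear maps
  such as \<open>frob n\<close> are covered as well as linear ones.\<close>

lemma span_preserved:
  assumes "f \<in> fv.span A" "\<And>a. a \<in> A \<Longrightarrow> g a \<in> fv.span B"
    and add: "\<And>u v. g (u + v) = g u + g v"
    and scale: "\<And>c u. \<exists>d. g (\<lambda>x. c * u x) = (\<lambda>x. d * g u x)"
  shows "g f \<in> fv.span (B :: ('c \<Rightarrow> 'a) set)"
proof -
  have "g 0 = 0" using add[of 0 0] by simp
  hence "fv.subspace {u. g u \<in> fv.span B}"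
    unfolding fv.subspace_def using add scale
    by (auto intro!: fv.span_add fv.span_zero) (metis fv.span_scale)
  thus ?thesis using fv.span_minimal[of A "{u. g u \<in> fv.span B}"] assms(1,2) by blast
qed

lemma span_frob: "f \<in> fv.span A \<Longrightarrow> frob n f \<in> fv.span (frob n ` A)"
  by (rule span_preserved[where g = "frob n"]) (auto intro: fv.span_base simp: frob_add frob_scale)

lemma span_times_left:
  assumes "f \<in> fv.span A" "\<And>a. a \<in> A \<Longrightarrow> a * g \<in> fv.span D"
  shows "f * g \<in> fv.span (D :: ('c \<Rightarrow> 'a) set)"
proof (rule span_preserved[where g = "\<lambda>f. f * g", OF assms])
  show "\<exists>d. (\<lambda>x. c * u x) * g = (\<lambda>x. d * (u * g) x)" for c u
    by (intro exI[of _ c]) (simp add: fun_eq_iff)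
qed (auto simp: distrib_right)

lemma span_times:
  assumes "f \<in> fv.span A" "g \<in> fv.span B" "\<And>a b. a \<in> A \<Longrightarrow> b \<in> B \<Longrightarrow> a * b \<in> fv.span D"
  shows "f * g \<in> fv.span (D :: ('c \<Rightarrow> 'a) set)"
proof (rule span_times_left[OF assms(1)])
  fix a assume "a \<in> A"
  hence "g * a \<in> fv.span D"
    using span_times_left[OF assms(2), of a D] assms(3) by (metis mult.commute)
  thus "a * g \<in> fv.span D" by (simp add: mult.commute)
qed

lemma span_subset_trans: "f \<in> fv.span A \<Longrightarrow> A \<subseteq> fv.span D \<Longrightarrow> f \<in> fv.span D"
  using fv.span_minimal[of A "fv.span D"] by auto

definition ca :: "'a \<times> 'a \<times> 'a \<Rightarrow> 'a" where "ca = (\<lambda>(a, b, c). a)"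
definition cb :: "'a \<times> 'a \<times> 'a \<Rightarrow> 'a" where "cb = (\<lambda>(a, b, c). b)"
definition cc :: "'a \<times> 'a \<times> 'a \<Rightarrow> 'a" where "cc = (\<lambda>(a, b, c). c)"

text \<open>\<open>True\<close> as first or second argument means that a carry enters or leaves the digit.\<close>

fun Lam :: "bool \<Rightarrow> bool \<Rightarrow> ('a \<times> 'a \<times> 'a \<Rightarrow> 'a) set" where
  "Lam True True = {1, ca, cb, cc}"
| "Lam True False = {ca * cb, ca * cc, cb * cc, ca * cb * cc}"
| "Lam False True = {1}"
| "Lam False False = {ca, cb, ca * cc, cb * cc, ca * cb + cc}"

text \<open>Digits are read upward from 0: \<open>s\<close> is the state below digit 0 and
  \<open>s'\<close> the state above digit \<open>n - 1\<close>. The start state stays free so that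
  the word can be closed to a cycle by \<open>s = s'\<close>.\<close>

fun words :: "nat \<Rightarrow> bool \<Rightarrow> bool \<Rightarrow> ('a \<times> 'a \<times> 'a \<Rightarrow> 'a) set" where
  "words 0 s s' = (if s = s' then {1} else {})"
| "words (Suc n) s s' =
    (\<lambda>(f, l). f * frob n l) ` (words n s False \<times> Lam False s' \<union> words n s True \<times> Lam True s')"

lemma words_SucI: "f \<in> words n s m \<Longrightarrow> l \<in> Lam m s' \<Longrightarrow> f * frob n l \<in> words (Suc n) s s'"
  by (cases m) (force simp: image_iff)+

lemma words_SucE:
  assumes "f \<in> words (Suc n) s s'"
  obtains g l m where "f = g * frob n l" "g \<in> words n s m" "l \<in> Lam m s'"
  using assms by auto

lemma finite_words: "finite (words n s s')"
proof (induction n arbitrary: s')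
  case (Suc n)
  have "finite (Lam m s')" for m by (cases m; cases s') simp_all
  thus ?case using Suc by simp
qed simp

lemma card_words: "card (words n s s') \<le> paths n s s'"
proof (induction n arbitrary: s')
  case (Suc n)
  have fin: "finite (Lam m s')" for m by (cases m; cases s') simp_all
  have "card (words (Suc n) s s') \<le> card (words n s False \<times> Lam False s' \<union> words n s True \<times> Lam True s')"
    unfolding words.simps by (intro card_image_le finite_UnI finite_cartesian_product finite_words fin)
  also have "\<dots> \<le> card (words n s False) * card (Lam False s') + card (words n s True) * card (Lam True s')"
    by (simp only: card_cartesian_product[symmetric] card_Un_le)
  also have "\<dots> \<le> paths n s False * card (Lam False s') + paths n s True * card (Lam True s')"
    by (intro add_mono mult_mono Suc) auto
  also have "\<dots> \<le> paths (Suc n) s s'"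
  proof (cases s')
    case True
    have "card (Lam True True) \<le> 4" by (simp add: card_insert_if)
    from mult_le_mono2[OF this, of "paths n s True"] show ?thesis using True by simp
  next
    case s': False
    hence eq: "s' = False" by simp
    have "card (Lam True False) \<le> 4" "card (Lam False False) \<le> 5" by (simp_all add: card_insert_if)
    from mult_le_mono2[OF this(1), of "paths n s True"] mult_le_mono2[OF this(2), of "paths n s False"]
    show ?thesis unfolding eq paths.simps by linarith
  qed
  finally show ?case .
qed simp

abbreviation "K \<equiv> Lam True True"

text \<open>The product has degree at most 3. Each monomial of it is either square-free of degree at
  least 2, which stops the carry, or a factor from \<open>K\<close> times the square of some
  \<open>k'\<close> in \<open>K\<close>; after the twist that square is the carry \<open>k'\<close>
  into the next digit.\<close>

lemma carry:
  assumes "k \<in> K" "l \<in> Lam False False"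
  shows "k * l \<in> fv.span (Lam True False \<union> {g * (k' * k') | g k'. g \<in> K \<and> k' \<in> K})"
    (is "_ \<in> fv.span ?D")
proof -
  have sq: "g * (k' * k') \<in> fv.span ?D" if "g \<in> K" "k' \<in> K" for g k'
    using that by (intro fv.span_base) blast
  have sf: "g \<in> fv.span ?D" if "g \<in> Lam True False" for g
    using that by (intro fv.span_base) blast
  have mixed: "g + h \<in> fv.span ?D" if "g \<in> fv.span ?D" "h \<in> fv.span ?D" for g h
    using that by (rule fv.span_add)
  have 1: "1 * l \<in> fv.span ?D"
    using assms(2) sq[of ca 1] sq[of cb 1] sf[of "ca * cc"] sf[of "cb * cc"]
      mixed[OF sf[of "ca * cb"] sq[of cc 1]] by auto
  have 2: "ca * l \<in> fv.span ?D"
    using assms(2) sq[of 1 ca] sf[of "ca * cb"] sq[of cc ca] sf[of "ca * cb * cc"]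
      mixed[OF sq[of cb ca] sf[of "ca * cc"]] by (auto simp: algebra_simps)
  have 3: "cb * l \<in> fv.span ?D"
    using assms(2) sq[of 1 cb] sf[of "ca * cb"] sq[of cc cb] sf[of "ca * cb * cc"]
      mixed[OF sq[of ca cb] sf[of "cb * cc"]] by (auto simp: algebra_simps)
  have 4: "cc * l \<in> fv.span ?D"
    using assms(2) sf[of "ca * cc"] sf[of "cb * cc"] sq[of ca cc] sq[of cb cc]
      mixed[OF sf[of "ca * cb * cc"] sq[of 1 cc]] by (auto simp: algebra_simps)
  show ?thesis using assms(1) 1 2 3 4 by auto
qed

text \<open>Words of \<open>n\<close> digits with a pending carry that is not yet merged with the
  letter at digit \<open>n\<close>.\<close>

abbreviation carried :: "('a \<times> 'a \<times> 'a \<Rightarrow> 'a) set \<Rightarrow> nat \<Rightarrow> ('a \<times> 'a \<times> 'a \<Rightarrow> 'a) set" where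
  "carried A n \<equiv> {f * frob n k | f k. f \<in> A \<and> k \<in> K}"

lemma carry_frob:
  assumes "k \<in> K" "l \<in> Lam False False"
  shows "frob n k * frob n l \<in> fv.span (frob n ` Lam True False \<union> carried (frob n ` K) (Suc n))"
proof -
  have "frob n (k * l) \<in> fv.span (frob n ` (Lam True False \<union> {g * (k' * k') | g k'. g \<in> K \<and> k' \<in> K}))"
    by (rule span_frob[OF carry[OF assms]])
  moreover have "frob n ` (Lam True False \<union> {g * (k' * k') | g k'. g \<in> K \<and> k' \<in> K})
      \<subseteq> frob n ` Lam True False \<union> carried (frob n ` K) (Suc n)"
    unfolding image_Un
  proof (intro Un_mono order_refl subsetI)
    fix u assume "u \<in> frob n ` {g * (k' * k') | g k'. g \<in> K \<and> k' \<in> K}"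
    then obtain g k' where u: "u = frob n (g * (k' * k'))" "g \<in> K" "k' \<in> K" by blast
    have "u = frob n g * frob (Suc n) k'" by (simp only: u(1) frob_mult[of n g] frob_square)
    thus "u \<in> carried (frob n ` K) (Suc n)" using u(2,3) by blast
  qed
  ultimately have "frob n (k * l) \<in> fv.span (frob n ` Lam True False \<union> carried (frob n ` K) (Suc n))"
    by (rule subsetD[OF fv.span_mono, rotated])
  thus ?thesis by (simp only: frob_mult)
qed

lemma carry_step:
  assumes "f \<in> words n s True" "k \<in> K" "l \<in> Lam False False"
  shows "f * (frob n k * frob n l) \<in>
    fv.span (words (Suc n) s False \<union> carried (words (Suc n) s True) (Suc n))"
proof -
  have "(frob n k * frob n l) * f \<in>
    fv.span (words (Suc n) s False \<union> carried (words (Suc n) s True) (Suc n))"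
  proof (rule span_times_left[OF carry_frob[OF assms(2,3)]])
    fix a assume "a \<in> frob n ` Lam True False \<union> carried (frob n ` K) (Suc n)"
    thus "a * f \<in> fv.span (words (Suc n) s False \<union> carried (words (Suc n) s True) (Suc n))"
    proof
      assume "a \<in> frob n ` Lam True False"
      hence "a * f \<in> words (Suc n) s False"
        using words_SucI[OF assms(1)] by (auto simp: mult.commute[of _ f] simp del: words.simps)
      thus ?thesis by (intro fv.span_base) blast
    next
      assume "a \<in> carried (frob n ` K) (Suc n)"
      then obtain g k' where a: "a = frob n g * frob (Suc n) k'" "g \<in> K" "k' \<in> K" by blast
      have "a * f = (f * frob n g) * frob (Suc n) k'" by (simp add: a mult_ac)
      moreover have "f * frob n g \<in> words (Suc n) s True" using words_SucI[OF assms(1) a(2)] .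
      ultimately show ?thesis using a(3) by (intro fv.span_base) blast
    qed
  qed
  thus ?thesis by (simp only: mult.commute[of f])
qed

lemma one_in_Lam: "1 \<in> Lam False True" "1 \<in> K" by simp_all

text \<open>A carry out of the top digit is a factor \<open>k\<close> at digit 0, since
  \<open>frob t\<close> is the identity. It travels upward as in \<open>carry_step\<close>. Where
  the word passes from \<open>False\<close> to \<open>True\<close> its letter is 1, and a carry
  still pending there becomes the letter itself; so a word ending in \<open>True\<close> emits no
  second carry.\<close>

lemma absorb:
  assumes "k \<in> K"
  shows "(f \<in> words n False True \<longrightarrow> k * f \<in> fv.span (words n True True)) \<and>
    (f \<in> words n False False \<longrightarrow>
      k * f \<in> fv.span (words n True False \<union> carried (words n True True) n))"
proof (induction n arbitrary: f)
  case 0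
  have "k \<in> carried (words 0 True True) 0"
    using assms by (intro CollectI exI[of _ 1] exI[of _ k]) (simp del: Lam.simps)
  hence "k * 1 \<in> fv.span (words 0 True False \<union> carried (words 0 True True) 0)"
    unfolding mult_1_right by (intro fv.span_base UnI2)
  moreover have "f = 1" if "f \<in> words 0 False False" using that by simp
  moreover have "f \<notin> words 0 False True" by simp
  ultimately show ?case by blast
next
  case (Suc n)
  have IH1: "k * g \<in> fv.span (words n True True)" if "g \<in> words n False True" for g
    using Suc that by blast
  have IH2: "k * g \<in> fv.span (words n True False \<union> carried (words n True True) n)"
    if "g \<in> words n False False" for g
    using Suc that by blast
  have A: "k * f \<in> fv.span (words (Suc n) True True)" if "f \<in> words (Suc n) False True"
  proof -
    obtain g l m where f: "f = g * frob n l" "g \<in> words n False m" "l \<in> Lam m True"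
      using \<open>f \<in> words (Suc n) False True\<close> by (rule words_SucE)
    show ?thesis
    proof (cases m)
      case True
      have "(k * g) * frob n l \<in> fv.span (words (Suc n) True True)"
      proof (rule span_times_left[OF IH1])
        show "a * frob n l \<in> fv.span (words (Suc n) True True)" if "a \<in> words n True True" for a
          by (rule fv.span_base, rule words_SucI[OF that]) (use f True in auto)
      qed (use f True in auto)
      thus ?thesis by (simp only: f mult.assoc)
    next
      case False
      have l: "l = 1" using f False by simp
      have "(k * g) * frob n l \<in> fv.span (words (Suc n) True True)"
      proof (rule span_times_left[OF IH2])
        fix a assume "a \<in> words n True False \<union> carried (words n True True) n"
        thus "a * frob n l \<in> fv.span (words (Suc n) True True)"
        proof
          assume "a \<in> words n True False"
          thus ?thesis using words_SucI[OF _ one_in_Lam(1)] by (intro fv.span_base) (simp only: l)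
        next
          assume "a \<in> carried (words n True True) n"
          then obtain u v where a: "a = u * frob n v" "u \<in> words n True True" "v \<in> K" by blast
          have "a * frob n l = u * frob n v" by (simp add: a l)
          thus ?thesis using words_SucI[OF a(2,3)] by (intro fv.span_base) (simp only:)
        qed
      qed (use f False in auto)
      thus ?thesis by (simp only: f mult.assoc)
    qed
  qed
  let ?D = "words (Suc n) True False \<union> carried (words (Suc n) True True) (Suc n)"
  have B: "k * f \<in> fv.span ?D" if "f \<in> words (Suc n) False False"
  proof -
    obtain g l m where f: "f = g * frob n l" "g \<in> words n False m" "l \<in> Lam m False"
      using \<open>f \<in> words (Suc n) False False\<close> by (rule words_SucE)
    show ?thesis
    proof (cases m)
      case True
      have "(k * g) * frob n l \<in> fv.span ?D"
      proof (rule span_times_left[OF IH1])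
        show "a * frob n l \<in> fv.span ?D" if "a \<in> words n True True" for a
          by (rule fv.span_base, rule UnI1, rule words_SucI[OF that]) (use f True in auto)
      qed (use f True in auto)
      thus ?thesis by (simp only: f mult.assoc)
    next
      case False
      have l: "l \<in> Lam False False" using f False by (simp del: Lam.simps)
      have "(k * g) * frob n l \<in> fv.span ?D"
      proof (rule span_times_left[OF IH2])
        fix a assume "a \<in> words n True False \<union> carried (words n True True) n"
        thus "a * frob n l \<in> fv.span ?D"
        proof
          assume "a \<in> words n True False"
          thus ?thesis using words_SucI[OF _ l] by (intro fv.span_base UnI1)
        next
          assume "a \<in> carried (words n True True) n"
          then obtain u v where a: "a = u * frob n v" "u \<in> words n True True" "v \<in> K" by blast
          have "a * frob n l = u * (frob n v * frob n l)" by (simp only: a mult.assoc)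
          thus ?thesis using carry_step[OF a(2,3) l] by (simp only:)
        qed
      qed (use f False in \<open>auto simp del: Lam.simps\<close>)
      thus ?thesis by (simp only: f mult.assoc)
    qed
  qed
  show ?case using A B by blast
qed

section \<open>Expansion of the indicator function of a line\<close>

definition ell1 :: "'a \<times> 'a \<times> 'a \<Rightarrow> 'a \<times> 'a \<times> 'a \<Rightarrow> 'a" where
  "ell1 = (\<lambda>(x, y, z) (a, b, c). b + (a * x + y))"

definition ell2 :: "'a \<times> 'a \<times> 'a \<Rightarrow> 'a \<times> 'a \<times> 'a \<Rightarrow> 'a" where
  "ell2 = (\<lambda>(x, y, z) (a, b, c). c + (a * y + z))"

lemma prod_frob: "(\<Prod>i<t. frob i f) = (\<lambda>p. if f p = 0 then 0 else 1)"
proof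
  fix p
  have "(\<Prod>i<t. frob i f) p = Xm {..<t} (f p)"
    by (simp add: prod_fun_apply frob_def Xm_def)
  thus "(\<Prod>i<t. frob i f) p = (if f p = 0 then 0 else 1)"
    by (simp only: Xm_full power_card_minus_1_eq)
qed

lemma line_fun_eq:
  "line_fun l = 1 + (\<Prod>i<t. frob i (ell1 l)) + (\<Prod>i<t. frob i (ell2 l)) + (\<Prod>i<t. frob i (ell1 l * ell2 l))"
  unfolding prod_frob
  using add_self[of 1]
  by (cases l) (auto simp: fun_eq_iff line_fun_def ell1_def ell2_def add_eq_0 add.assoc)

lemma prod_frob_words:
  assumes "f \<in> fv.span K" shows "(\<Prod>i<n. frob i f) \<in> fv.span (words n True True)"
proof (induction n)
  case 0
  show ?case unfolding lessThan_0 prod.empty by (intro fv.span_base) (simp add: one_fun_def)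
next
  case (Suc n)
  have "(\<Prod>i<n. frob i f) * frob n f \<in> fv.span (words (Suc n) True True)"
    by (rule span_times[OF Suc span_frob[OF assms]])
      (auto intro!: fv.span_base words_SucI simp del: words.simps Lam.simps)
  thus ?case by (simp only: prod.lessThan_Suc)
qed

lemma ell_span: "ell1 l \<in> fv.span K" "ell2 l \<in> fv.span K"
proof -
  obtain x y z where l: "l = (x, y, z)" by (cases l)
  have "ell1 l = cb + ((\<lambda>p. x * ca p) + (\<lambda>p. y * 1 p))"
    by (auto simp: fun_eq_iff ell1_def l ca_def cb_def mult.commute)
  also have "\<dots> \<in> fv.span K" by (intro fv.span_add fv.span_scale fv.span_base) auto
  finally show "ell1 l \<in> fv.span K" .
  have "ell2 l = cc + ((\<lambda>p. y * ca p) + (\<lambda>p. z * 1 p))"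
    by (auto simp: fun_eq_iff ell2_def l ca_def cc_def mult.commute)
  also have "\<dots> \<in> fv.span K" by (intro fv.span_add fv.span_scale fv.span_base) auto
  finally show "ell2 l \<in> fv.span K" .
qed

text \<open>The linear forms \<open>ell1\<close> and \<open>ell2\<close> are orthogonal for the symplectic form on the dual space;
  this is why \<open>ab\<close> and \<open>c\<close> have equal coefficients in their product.\<close>

lemma ell_mult_span: "ell1 l * ell2 l \<in> fv.span (Lam False False \<union> {k * k | k. k \<in> K})"
proof -
  obtain x y z where l: "l = (x, y, z)" by (cases l)
  have "ell1 l * ell2 l =
      (\<lambda>p. x * (ca * cc) p) + (\<lambda>p. (x * z + y * y) * ca p) + (\<lambda>p. y * (ca * cb + cc) p) + cb * cc +
      (\<lambda>p. z * cb p) + (\<lambda>p. (x * y) * (ca * ca) p) + (\<lambda>p. (y * z) * (1 * 1) p)"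
  proof
    fix p :: "'a \<times> 'a \<times> 'a"
    obtain a b c where p: "p = (a, b, c)" by (cases p)
    show "(ell1 l * ell2 l) p =
      ((\<lambda>p. x * (ca * cc) p) + (\<lambda>p. (x * z + y * y) * ca p) + (\<lambda>p. y * (ca * cb + cc) p) + cb * cc +
      (\<lambda>p. z * cb p) + (\<lambda>p. (x * y) * (ca * ca) p) + (\<lambda>p. (y * z) * (1 * 1) p)) p"
      unfolding p l plus_fun_def times_fun_def one_fun_def ell1_def ell2_def ca_def cb_def cc_def prod.case
      by (simp add: algebra_simps)
  qed
  note eq = this
  have *: "ca * cb + cc \<in> fv.span (Lam False False \<union> {k * k | k. k \<in> K})"
    by (intro fv.span_base UnI1) simp
  show ?thesis unfolding eq
  proof (intro * fv.span_add fv.span_scale fv.span_base)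
    have "ca \<in> K" by simp
    thus "ca * ca \<in> Lam False False \<union> {k * k | k. k \<in> K}" by blast
    show "1 * 1 \<in> Lam False False \<union> {k * k | k. k \<in> K}" by (rule UnI2) (use one_in_Lam(2) in blast)
  qed auto
qed

text \<open>A square \<open>k * k\<close> chosen at a digit becomes the carry \<open>k\<close> into
  the next one and leaves the digit itself empty: its letter is then 1 if no carry arrives and the
  arriving carry otherwise. This explains \<open>Lam False True\<close> and
  \<open>Lam True True\<close>.\<close>

lemma prod_ell_words:
  "(\<Prod>i<n. frob i (ell1 l * ell2 l)) \<in>
    fv.span (words n False False \<union> carried (words n False True) n)"
proof (induction n)
  case 0
  show ?case unfolding lessThan_0 prod.empty by (intro fv.span_base) (simp add: one_fun_def)
next
  case (Suc n)
  let ?D = "words (Suc n) False False \<union> carried (words (Suc n) False True) (Suc n)"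
  have "(\<Prod>i<n. frob i (ell1 l * ell2 l)) * frob n (ell1 l * ell2 l) \<in> fv.span ?D"
  proof (rule span_times[OF Suc span_frob[OF ell_mult_span]])
    fix a b assume a: "a \<in> words n False False \<union> carried (words n False True) n"
      and b: "b \<in> frob n ` (Lam False False \<union> {k * k | k. k \<in> K})"
    consider (1) l where "b = frob n l" "l \<in> Lam False False"
      | (2) k where "b = frob (Suc n) k" "k \<in> K"
      using b by (auto simp: frob_square simp del: Lam.simps)
    note b = this
    from a show "a * b \<in> fv.span ?D"
    proof
      assume a: "a \<in> words n False False"
      from b show ?thesis
      proof cases
        case 1
        show ?thesis unfolding 1 by (rule fv.span_base, rule UnI1, rule words_SucI[OF a 1(2)])
      next
        case 2
        have "a * b = (a * frob n 1) * frob (Suc n) k" by (simp add: 2)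
        thus ?thesis using words_SucI[OF a one_in_Lam(1)] 2(2) by (intro fv.span_base UnI2) blast
      qed
    next
      assume "a \<in> carried (words n False True) n"
      then obtain f k where a: "a = f * frob n k" "f \<in> words n False True" "k \<in> K" by blast
      from b show ?thesis
      proof cases
        case 1
        show ?thesis unfolding 1 a using carry_step[OF a(2,3) 1(2)] by (simp only: mult.assoc)
      next
        case 2
        show ?thesis unfolding 2 a using words_SucI[OF a(2,3)] 2(2) by (intro fv.span_base UnI2) blast
      qed
    qed
  qed
  thus ?case by (simp only: prod.lessThan_Suc)
qed

abbreviation "cyclic_words \<equiv> words t False False \<union> words t True True"

lemma line_fun_words: "line_fun l \<in> fv.span cyclic_words"
proof -
  have 1: "f \<in> fv.span cyclic_words" if "f \<in> fv.span (words t True True)" for f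
    using that fv.span_mono[of "words t True True" cyclic_words] by blast
  have "words t False False \<union> carried (words t False True) t \<subseteq> fv.span cyclic_words"
  proof (intro Un_least subsetI)
    fix f assume "f \<in> carried (words t False True) t"
    then obtain g k where f: "f = k * g" "g \<in> words t False True" "k \<in> K"
      by (auto simp: frob_card mult.commute simp del: Lam.simps)
    thus "f \<in> fv.span cyclic_words" using absorb[OF f(3), of g t] 1 by blast
  qed (auto intro: fv.span_base)
  hence "(\<Prod>i<t. frob i (ell1 l * ell2 l)) \<in> fv.span cyclic_words"
    using prod_ell_words span_subset_trans by blast
  moreover have "(1 :: 'a \<times> 'a \<times> 'a \<Rightarrow> 'a) = (\<Prod>i<t. frob i 1)" by simp
  hence "1 \<in> fv.span cyclic_words"
    using prod_frob_words[OF fv.span_base[OF one_in_Lam(2)], of t] 1 by metis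
  ultimately show ?thesis unfolding line_fun_eq
    by (intro fv.span_add) (auto intro!: 1 prod_frob_words ell_span simp del: Lam.simps)
qed

end

section \<open>The upper bound\<close>

context char2_field
begin

lemma sum_Xm_full: "(\<Sum>b\<in>UNIV. Xm {..<t} b) = (1::'a)"
proof -
  have "(\<Sum>b\<in>(UNIV::'a set). 1) = (0::'a)"
    using t_pos two_eq_zero by (simp add: card_field)
  thus ?thesis using chi_Xm[of "{}" "{}"] by (simp add: chi_def sum.distrib)
qed

definition word2 :: "('a \<times> 'a \<times> 'a \<Rightarrow> 'a) \<Rightarrow> ('a \<times> 'a \<times> 'a \<Rightarrow> 'a) \<Rightarrow> nat set \<Rightarrow> 'a \<times> 'a \<times> 'a \<Rightarrow> 'a"
  where "word2 f g r = (\<Prod>i<t. frob i (if i \<in> r then f else g))"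

lemma prod_words:
  assumes "\<And>i. i < n \<Longrightarrow> l i \<in> Lam s s"
  shows "(\<Prod>i<n. frob i (l i)) \<in> words n s s"
  using assms
proof (induction n)
  case (Suc n)
  thus ?case using words_SucI[of _ n s s "l n" s] by (simp only: prod.lessThan_Suc lessI less_SucI)
qed (simp add: one_fun_def)

lemma word2_eq: "r \<subseteq> {..<t} \<Longrightarrow> word2 f g r p = Xm r (f p) * Xm ({..<t} - r) (g p)"
proof -
  assume r: "r \<subseteq> {..<t}"
  have "word2 f g r p = (\<Prod>i<t. if i \<in> r then f p ^ (2 ^ i) else g p ^ (2 ^ i))"
    unfolding word2_def prod_fun_apply by (intro prod.cong refl) (simp add: frob_def)
  also have "\<dots> = Xm ({..<t} \<inter> r) (f p) * Xm ({..<t} \<inter> - r) (g p)"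
    unfolding Xm_def by (subst prod.If_cases) auto
  also have "{..<t} \<inter> r = r" using r by blast
  also have "{..<t} \<inter> - r = {..<t} - r" by blast
  finally show ?thesis .
qed

lemma Xm_one[simp]: "Xm r 1 = 1" by (simp add: Xm_def)

lemma Xm_inj: assumes "r \<subseteq> {..<t}" "r' \<subseteq> {..<t}" "\<And>x. Xm r x = Xm r' x" shows "r = r'"
  using chi_Xm[OF assms(1,1)] chi_Xm[OF assms(1,2)] assms(3) by (auto split: if_splits)

lemma inj_word2:
  assumes "\<And>x. \<exists>p. f p = x \<and> g p = 1"
  shows "inj_on (word2 f g) (Pow {..<t})"
proof (rule inj_onI)
  fix r r' assume r: "r \<in> Pow {..<t}" "r' \<in> Pow {..<t}" and eq: "word2 f g r = word2 f g r'"
  have "Xm r x = Xm r' x" for x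
  proof -
    obtain p where "f p = x" "g p = 1" using assms by blast
    thus ?thesis using fun_cong[OF eq, of p] r by (simp add: word2_eq)
  qed
  thus "r = r'" using Xm_inj r by auto
qed

text \<open>A line of \<open>L\<^sub>1\<close> meets both or neither of the point sets \<open>{(u, b, 0) | b}\<close> and \<open>{(0, b, u * b) | b}\<close>.\<close>

definition phi :: "'a \<Rightarrow> ('a \<times> 'a \<times> 'a \<Rightarrow> 'a) \<Rightarrow> 'a" where
  "phi u f = (\<Sum>b\<in>UNIV. f (u, b, 0)) + (\<Sum>b\<in>UNIV. f (0, b, u * b))"

text \<open>For \<open>u \<noteq> 0\<close> the two sets are the points off \<open>ell0\<close> of
  two hyperbolic lines that are perpendicular to each other because 2 = 0. A totally isotropic line
  through a point of one lies, like the other, in the plane perpendicular to that point, so the two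
  meet. In coordinates both conditions become \<open>u * y + z = 0\<close>.\<close>

lemma phi_line: "phi u (line_fun l) = 0"
proof -
  obtain x y z where l: "l = (x, y, z)" by (cases l)
  have "(\<Sum>b\<in>UNIV. line_fun l (u, b, 0)) =
      (\<Sum>b\<in>UNIV. if b = u * x + y then (if u * y + z = 0 then 1 else 0) else 0)"
    unfolding l line_fun_def by (intro sum.cong refl) auto
  moreover have "(\<Sum>b\<in>UNIV. line_fun l (0, b, u * b)) =
      (\<Sum>b\<in>UNIV. if b = y then (if u * y + z = 0 then 1 else 0) else 0)"
    unfolding l line_fun_def by (intro sum.cong refl) (auto simp: add_eq_0)
  ultimately show ?thesis unfolding phi_def by (simp add: add_self)
qed

text \<open>For nonempty \<open>k\<close> this is the coefficient of \<open>Xm k\<close> in the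
  function \<open>\<lambda>u. phi u f\<close>, because \<open>chi k\<close> then has no constant
  correction.\<close>

definition psi :: "nat set \<Rightarrow> ('a \<times> 'a \<times> 'a \<Rightarrow> 'a) \<Rightarrow> 'a" where
  "psi k f = (\<Sum>u\<in>UNIV. Xm ({..<t} - k) u * phi u f)"

lemma psi_line: "psi k (line_fun l) = 0"
  by (simp add: psi_def phi_line)

lemma psi_add: "psi k (f + g) = psi k f + psi k g"
  by (simp add: psi_def phi_def sum.distrib algebra_simps)

lemma psi_scale: "psi k (\<lambda>p. c * f p) = c * psi k f"
  by (simp add: psi_def phi_def sum_distrib_left algebra_simps)

text \<open>On the first point set \<open>c = 0\<close>, so the word vanishes there. On the second
  \<open>c = u * b\<close>, and the word becomes \<open>Xm l u * b ^ (q - 1)\<close>, whose sum over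
  \<open>b\<close> is \<open>Xm l u\<close>.\<close>

lemma psi_word2:
  assumes k: "k \<subseteq> {..<t}" "k \<noteq> {}" and l: "l \<subseteq> {..<t}" "l \<noteq> {}"
  shows "psi k (word2 cc cb l) = (if k = l then 1 else 0)"
proof -
  have fin: "finite l" using l finite_subset by blast
  have "phi u (word2 cc cb l) = Xm l u" for u
  proof -
    have "Xm l (u * b) * Xm ({..<t} - l) b = Xm l u * Xm {..<t} b" for b
    proof -
      have "Xm {..<t} b = Xm l b * Xm ({..<t} - l) b"
        using Xm_Un_disjoint[of l "{..<t} - l" b] fin l by (simp add: Un_absorb1)
      thus ?thesis by (simp add: Xm_mult)
    qed
    thus ?thesis using l fin
      by (simp add: phi_def word2_eq cc_def cb_def Xm_zero sum_distrib_left[symmetric] sum_Xm_full)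
  qed
  thus ?thesis using chi_Xm[OF k(1) l(1)] k by (simp add: psi_def chi_def)
qed

lemma rank_upper:
  "rank_F2_M F + 2 ^ t + (2 ^ t - 1) \<le> paths t False False + paths t True True"
proof -
  let ?A = "words t False False" and ?B = "words t True True"
  let ?P = "Pow {..<t}"
  define Om where "Om = word2 cc cb ` (?P - {{}})"
  \<comment> \<open>The functions \<open>ca\<close> and \<open>cb\<close> belong both to
    \<open>Lam False False\<close> and to \<open>Lam True True\<close>; words in these two letters
    are counted in both states.\<close>
  have "word2 ca cb ` ?P \<subseteq> ?A \<inter> ?B"
    unfolding word2_def by (auto intro!: prod_words)
  moreover have fin: "finite ?A" "finite ?B" by (rule finite_words)+
  moreover have "inj_on (word2 ca cb) ?P"
    by (rule inj_word2) (auto simp: ca_def cb_def)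
  ultimately have "2 ^ t \<le> card (?A \<inter> ?B)"
    using card_mono[of "?A \<inter> ?B" "word2 ca cb ` ?P"] by (simp add: card_image card_Pow)
  hence AB: "card (?A \<union> ?B) + 2 ^ t \<le> paths t False False + paths t True True"
    using card_Un_Int[OF fin] card_words[of t False False] card_words[of t True True] by linarith
  have "(if i \<in> r then cc else cb) \<in> K" for i :: nat and r by simp
  hence "Om \<subseteq> ?B"
    unfolding Om_def word2_def by (auto intro!: prod_words simp del: Lam.simps)
  hence Om: "Om \<subseteq> ?A \<union> ?B" by blast
  have "inj_on (word2 cc cb) ?P"
    by (rule inj_word2) (auto simp: cc_def cb_def)
  hence "card Om = 2 ^ t - 1"
    unfolding Om_def by (subst card_image) (auto simp: card_Pow card_Diff_singleton inj_on_diff)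
  moreover have "finite (?A \<union> ?B)" using fin by blast
  ultimately have card: "card (?A \<union> ?B - Om) + (2 ^ t - 1) = card (?A \<union> ?B)"
    using Om card_Diff_subset[of Om "?A \<union> ?B"] card_mono[of "?A \<union> ?B" Om] finite_subset[OF Om]
    by linarith
  \<comment> \<open>Projection along the span of \<open>Om\<close> to the common kernel of the
    \<open>psi k\<close>; the sign of the sum is immaterial in characteristic 2. It kills
    \<open>Om\<close> and fixes every line function, so the images of the remaining words
    suffice.\<close>
  define proj where "proj f = f + (\<Sum>k\<in>?P - {{}}. (\<lambda>p. psi k f * word2 cc cb k p))" for f
  have proj_add: "proj (f + g) = proj f + proj g" for f g
    by (simp add: proj_def fun_eq_iff sum_fun_apply psi_add sum.distrib algebra_simps)
  have proj_scale: "proj (\<lambda>p. c * f p) = (\<lambda>p. c * proj f p)" for f c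
  proof
    fix p
    have "proj (\<lambda>p. c * f p) p = c * f p + (\<Sum>k\<in>?P - {{}}. c * psi k f * word2 cc cb k p)"
      by (simp only: proj_def plus_fun_def sum_fun_apply psi_scale)
    also have "\<dots> = c * proj f p"
      by (simp only: proj_def plus_fun_def sum_fun_apply sum_distrib_left distrib_left mult.assoc)
    finally show "proj (\<lambda>p. c * f p) p = c * proj f p" .
  qed
  have proj_Om: "proj f = 0" if "f \<in> Om" for f
  proof -
    from that[unfolded Om_def] obtain l where l: "f = word2 cc cb l" "l \<subseteq> {..<t}" "l \<noteq> {}"
      by (elim imageE DiffE) auto
    have "(\<Sum>k\<in>?P - {{}}. psi k f * word2 cc cb k p) = f p" for p
    proof -
      have "(\<Sum>k\<in>?P - {{}}. psi k f * word2 cc cb k p) = (\<Sum>k\<in>?P - {{}}. if k = l then f p else 0)"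
        using l by (intro sum.cong refl) (auto simp: psi_word2)
      thus ?thesis using l by simp
    qed
    thus ?thesis unfolding proj_def by (intro ext) (simp add: sum_fun_apply add_self)
  qed
  let ?W = "proj ` (?A \<union> ?B - Om)"
  have "line_fun l \<in> fv.span ?W" for l
  proof -
    have "proj (line_fun l) \<in> fv.span ?W"
    proof (rule span_preserved[where g = proj, OF line_fun_words])
      show "proj a \<in> fv.span ?W" if "a \<in> ?A \<union> ?B" for a
        using that proj_Om[of a] fv.span_zero by (cases "a \<in> Om") (auto intro: fv.span_base)
    qed (use proj_add proj_scale in blast)+
    moreover have "proj (line_fun l) = line_fun l"
      by (simp add: proj_def fun_eq_iff sum_fun_apply psi_line)
    ultimately show ?thesis by simp
  qed
  hence "rank_F2_M F \<le> card ?W"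
    using fin by (intro rank_le) auto
  also have "\<dots> \<le> card (?A \<union> ?B - Om)" using fin by (intro card_image_le) auto
  finally show ?thesis using AB card by linarith
qed

end

section \<open>The square-free algebra\<close>

datatype var = A nat | B nat | C nat

definition as :: "var set \<Rightarrow> nat set" where "as X = {i. A i \<in> X}"
definition bs :: "var set \<Rightarrow> nat set" where "bs X = {i. B i \<in> X}"
definition cs :: "var set \<Rightarrow> nat set" where "cs X = {i. C i \<in> X}"

text \<open>The degree in the grading where each \<open>A i\<close> has degree -1 and each
  \<open>B i\<close> and \<open>C i\<close> degree 2. Both terms of \<open>theta i\<close> then have
  degree 1.\<close>

definition defect :: "var set \<Rightarrow> int" where
  "defect X = 2 * (int (card (bs X)) + int (card (cs X))) - int (card (as X))"

lemma as_simps[simp]: "as {} = {}" "as (insert (A i) X) = insert i (as X)"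
    "as (insert (B i) X) = as X" "as (insert (C i) X) = as X" "as (X \<union> Y) = as X \<union> as Y"
    "as (X - Y) = as X - as Y"
  by (auto simp: as_def)

lemma bs_simps[simp]: "bs {} = {}" "bs (insert (A i) X) = bs X"
    "bs (insert (B i) X) = insert i (bs X)" "bs (insert (C i) X) = bs X" "bs (X \<union> Y) = bs X \<union> bs Y"
    "bs (X - Y) = bs X - bs Y"
  by (auto simp: bs_def)

lemma cs_simps[simp]: "cs {} = {}" "cs (insert (A i) X) = cs X"
    "cs (insert (B i) X) = cs X" "cs (insert (C i) X) = insert i (cs X)" "cs (X \<union> Y) = cs X \<union> cs Y"
    "cs (X - Y) = cs X - cs Y"
  by (auto simp: cs_def)

lemma mem_as_bs_cs: "i \<in> as X \<longleftrightarrow> A i \<in> X" "i \<in> bs X \<longleftrightarrow> B i \<in> X" "i \<in> cs X \<longleftrightarrow> C i \<in> X"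
  by (auto simp: as_def bs_def cs_def)

lemma var_set_subset_iff: "X \<subseteq> Y \<longleftrightarrow> as X \<subseteq> as Y \<and> bs X \<subseteq> bs Y \<and> cs X \<subseteq> cs Y"
proof
  assume *: "as X \<subseteq> as Y \<and> bs X \<subseteq> bs Y \<and> cs X \<subseteq> cs Y"
  show "X \<subseteq> Y"
  proof
    fix v assume "v \<in> X"
    thus "v \<in> Y" using * by (cases v) (auto simp: as_def bs_def cs_def)
  qed
qed (auto simp: as_def bs_def cs_def)

context char2_field
begin

text \<open>Polynomials with square-free monomials are encoded as functions on sets of variables, and
  \<open>mul v\<close> is multiplication by \<open>v\<close>, where \<open>v * v = 0\<close>.\<close>

definition mul :: "var \<Rightarrow> (var set \<Rightarrow> 'a) \<Rightarrow> var set \<Rightarrow> 'a" where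
  "mul v G = (\<lambda>X. if v \<in> X then G (X - {v}) else 0)"

lemma mul_add: "mul v (G + H) = mul v G + mul v H"
  by (auto simp: mul_def fun_eq_iff)

lemma mul_scale: "mul v (\<lambda>X. c * G X) = (\<lambda>X. c * mul v G X)"
  by (auto simp: mul_def fun_eq_iff)

lemma mul_commute: "mul v (mul w G) = mul w (mul v G)"
proof
  fix X
  have "X - {v} - {w} = X - {w} - {v}" by blast
  thus "mul v (mul w G) X = mul w (mul v G) X" by (auto simp: mul_def)
qed

lemma mul_mul_same: "mul v (mul v G) = 0"
  by (auto simp: mul_def fun_eq_iff)

definition theta :: "nat \<Rightarrow> (var set \<Rightarrow> 'a) \<Rightarrow> var set \<Rightarrow> 'a" where
  "theta i G = mul (A i) (mul (B i) G) + mul (A (sig i)) (mul (C i) G)"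

lemma theta_add: "theta i (G + H) = theta i G + theta i H"
  by (simp add: theta_def mul_add algebra_simps)

lemma theta_scale: "theta i (\<lambda>X. c * G X) = (\<lambda>X. c * theta i G X)"
  by (simp add: theta_def mul_scale plus_fun_def distrib_left)

lemma mul_zero: "mul v 0 = 0" by (auto simp: mul_def fun_eq_iff)

lemma fun_add_self: "f + f = (0 :: 'b \<Rightarrow> 'a)" by (rule ext) (simp only: plus_fun_def add_self zero_fun_def)

lemma theta_theta: "theta i (theta i G) = 0"
proof -
  have "theta i (theta i G) =
      mul (A i) (mul (B i) (mul (A i) (mul (B i) G))) + mul (A i) (mul (B i) (mul (A (sig i)) (mul (C i) G))) +
      (mul (A (sig i)) (mul (C i) (mul (A i) (mul (B i) G))) +
       mul (A (sig i)) (mul (C i) (mul (A (sig i)) (mul (C i) G))))"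
    unfolding theta_def mul_add ..
  also have "mul (A i) (mul (B i) (mul (A i) (mul (B i) G))) = 0"
    by (metis mul_commute mul_mul_same mul_zero)
  also have "mul (A (sig i)) (mul (C i) (mul (A (sig i)) (mul (C i) G))) = 0"
    by (metis mul_commute mul_mul_same mul_zero)
  also have "mul (A (sig i)) (mul (C i) (mul (A i) (mul (B i) G))) =
      mul (A i) (mul (B i) (mul (A (sig i)) (mul (C i) G)))"
    by (metis mul_commute)
  finally show ?thesis by (simp only: add_0_left add_0_right fun_add_self)
qed

lemma mul_B_theta: "mul (B i) (theta i G) = mul (B i) (mul (A (sig i)) (mul (C i) G))"
proof -
  have "mul (B i) (mul (A i) (mul (B i) G)) = 0" by (metis mul_commute mul_mul_same mul_zero)
  thus ?thesis by (simp add: theta_def mul_add)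
qed

lemma mul_C_theta: "mul (C i) (theta i G) = mul (A i) (mul (B i) (mul (C i) G))"
proof -
  have "mul (C i) (mul (A (sig i)) (mul (C i) G)) = 0" by (metis mul_commute mul_mul_same mul_zero)
  moreover have "mul (C i) (mul (A i) (mul (B i) G)) = mul (A i) (mul (B i) (mul (C i) G))"
    by (metis mul_commute)
  ultimately show ?thesis by (simp add: theta_def mul_add)
qed

lemma mul_AB: "mul (A i) (mul (B i) G) = theta i G + mul (C i) (mul (A (sig i)) G)"
proof -
  have "mul (C i) (mul (A (sig i)) G) = mul (A (sig i)) (mul (C i) G)" by (rule mul_commute)
  thus ?thesis by (simp add: theta_def add.assoc fun_add_self)
qed

lemma theta_mul_A: "theta i (mul (A (sig i)) G) = mul (A i) (mul (B i) (mul (A (sig i)) G))"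
proof -
  have "mul (A (sig i)) (mul (C i) (mul (A (sig i)) G)) = 0" by (metis mul_commute mul_mul_same mul_zero)
  thus ?thesis by (simp add: theta_def)
qed

section \<open>The graded subalgebra\<close>

definition BC :: "var set" where "BC = B ` {..<t} \<union> C ` {..<t}"

lemma BC_iff[simp]: "A i \<notin> BC" "B i \<in> BC \<longleftrightarrow> i < t" "C i \<in> BC \<longleftrightarrow> i < t" by (auto simp: BC_def)

definition Var :: "var set" where "Var = A ` {..<t} \<union> BC"

lemma as_bs_cs_Var: "as Var = {..<t}" "bs Var = {..<t}" "cs Var = {..<t}"
  and as_bs_cs_BC: "as BC = {}" "bs BC = {..<t}" "cs BC = {..<t}"
  by (auto simp: Var_def as_def bs_def cs_def)

text \<open>Expanding the product of the \<open>theta i\<close>, one picks \<open>a_i b_i\<close>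
  for \<open>i\<close> in \<open>r\<close> and \<open>a_(i+1) c_i\<close> for \<open>i\<close> in
  \<open>s\<close>. The disjointness conditions say that the digits of \<open>f\<close> are split
  and that no \<open>A\<close> occurs twice. Since \<open>X\<close> and \<open>p\<close> determine
  \<open>r\<close> and \<open>s\<close>, every coefficient is 0 or 1.\<close>

definition lead_cond :: "var set \<Rightarrow> nat set \<Rightarrow> var set \<Rightarrow> bool" where
  "lead_cond p f X \<longleftrightarrow> p \<subseteq> X \<and> (let r = bs X - bs p; s = cs X - cs p in
     r \<inter> s = {} \<and> r \<union> s = f \<and> r \<inter> sig ` s = {} \<and> as X = r \<union> sig ` s)"

text \<open>\<open>Ghat p f\<close> is the product of the variables in \<open>p\<close> and the \<open>theta i\<close> with \<open>i \<in> f\<close>.\<close>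

definition Ghat :: "var set \<Rightarrow> nat set \<Rightarrow> var set \<Rightarrow> 'a" where
  "Ghat p f X = (if lead_cond p f X then 1 else 0)"

definition gens :: "int \<Rightarrow> (var set \<Rightarrow> 'a) set" where
  "gens n = {Ghat p f | p f. p \<subseteq> BC \<and> f \<subseteq> {..<t} \<and> 2 * int (card p) + int (card f) = n}"

text \<open>The homogeneous part of degree \<open>n\<close> of the subalgebra. Degrees are integers
  because division by a degree, as in \<open>n - 1\<close>, is not truncated when a variable
  \<open>A k\<close> is multiplied in.\<close>

definition S :: "int \<Rightarrow> (var set \<Rightarrow> 'a) set" where "S n = fv.span (gens n)"

lemma mul_B_Ghat: "mul (B i) (Ghat p f) = (if B i \<in> p then 0 else Ghat (insert (B i) p) f)"
proof
  fix X
  show "mul (B i) (Ghat p f) X = (if B i \<in> p then 0 else Ghat (insert (B i) p) f) X"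
  proof (cases "B i \<in> X \<and> B i \<notin> p")
    case True
    hence "bs (X - {B i}) - bs p = bs X - bs (insert (B i) p)" "cs (X - {B i}) - cs p = cs X - cs (insert (B i) p)"
       "p \<subseteq> X - {B i} \<longleftrightarrow> insert (B i) p \<subseteq> X" "as (X - {B i}) = as X"
      by auto
    hence "lead_cond p f (X - {B i}) \<longleftrightarrow> lead_cond (insert (B i) p) f X"
      unfolding lead_cond_def by simp
    thus ?thesis using True by (simp add: mul_def Ghat_def)
  qed (auto simp: mul_def Ghat_def lead_cond_def)
qed

lemma mul_C_Ghat: "mul (C i) (Ghat p f) = (if C i \<in> p then 0 else Ghat (insert (C i) p) f)"
proof
  fix X
  show "mul (C i) (Ghat p f) X = (if C i \<in> p then 0 else Ghat (insert (C i) p) f) X"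
  proof (cases "C i \<in> X \<and> C i \<notin> p")
    case True
    hence "bs (X - {C i}) - bs p = bs X - bs (insert (C i) p)" "cs (X - {C i}) - cs p = cs X - cs (insert (C i) p)"
       "p \<subseteq> X - {C i} \<longleftrightarrow> insert (C i) p \<subseteq> X" "as (X - {C i}) = as X"
      by auto
    hence "lead_cond p f (X - {C i}) \<longleftrightarrow> lead_cond (insert (C i) p) f X"
      unfolding lead_cond_def by simp
    thus ?thesis using True by (simp add: mul_def Ghat_def)
  qed (auto simp: mul_def Ghat_def lead_cond_def)
qed

lemma theta_Ghat:
  assumes "i < t" "i \<notin> f" "f \<subseteq> {..<t}" "p \<subseteq> BC"
  shows "theta i (Ghat p f) = Ghat p (insert i f)"
proof
  fix X
  define r s U where "r = bs X - bs p" and "s = cs X - cs p" and "U = as X"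
  have pA: "A j \<notin> p" for j using assms(4) by auto
  have inj: "sig j = sig i \<longleftrightarrow> j = i" if "j < t" for j
    using inj_on_sig assms(1) that by (auto dest: inj_onD)
  \<comment> \<open>The new factor contributes \<open>a_i b_i\<close> or \<open>a_(i+1) c_i\<close>;
    \<open>c1\<close> and \<open>c2\<close> describe the two ways to obtain \<open>X\<close>. They
    exclude each other, so nothing cancels.\<close>
  define c1 where "c1 \<longleftrightarrow> A i \<in> X \<and> B i \<in> X \<and> lead_cond p f (X - {A i} - {B i})"
  define c2 where "c2 \<longleftrightarrow> A (sig i) \<in> X \<and> C i \<in> X \<and> lead_cond p f (X - {A (sig i)} - {C i})"
  have c1: "c1 \<longleftrightarrow> lead_cond p (insert i f) X \<and> i \<in> r"
  proof -
    have "c1 \<longleftrightarrow> p \<subseteq> X \<and> i \<in> U \<and> i \<in> r \<and> (r - {i}) \<inter> s = {} \<and> (r - {i}) \<union> s = f \<and>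
        (r - {i}) \<inter> sig ` s = {} \<and> U - {i} = (r - {i}) \<union> sig ` s"
    proof -
      have "bs (X - {A i} - {B i}) - bs p = r - {i}" "cs (X - {A i} - {B i}) - cs p = s"
        "as (X - {A i} - {B i}) = U - {i}" by (auto simp: r_def s_def U_def)
      moreover have "p \<subseteq> X - {A i} - {B i} \<longleftrightarrow> p \<subseteq> X \<and> B i \<notin> p" using pA by blast
      moreover have "i \<in> U \<longleftrightarrow> A i \<in> X" "i \<in> r \<longleftrightarrow> B i \<in> X \<and> B i \<notin> p"
        by (auto simp: r_def U_def mem_as_bs_cs)
      ultimately show ?thesis unfolding c1_def lead_cond_def Let_def by (simp only:) blast
    qed
    also have "\<dots> \<longleftrightarrow> p \<subseteq> X \<and> r \<inter> s = {} \<and> r \<union> s = insert i f \<and> r \<inter> sig ` s = {} \<and> U = r \<union> sig ` s \<and> i \<in> r"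
      using assms(2) by blast
    finally show ?thesis
      unfolding lead_cond_def Let_def r_def[symmetric] s_def[symmetric] U_def[symmetric] by (simp only: conj_assoc)
  qed
  have c2: "c2 \<longleftrightarrow> lead_cond p (insert i f) X \<and> i \<in> s"
  proof -
    have "c2 \<longleftrightarrow> p \<subseteq> X \<and> sig i \<in> U \<and> i \<in> s \<and> r \<inter> (s - {i}) = {} \<and> r \<union> (s - {i}) = f \<and>
        r \<inter> sig ` (s - {i}) = {} \<and> U - {sig i} = r \<union> sig ` (s - {i})"
    proof -
      have "bs (X - {A (sig i)} - {C i}) - bs p = r" "cs (X - {A (sig i)} - {C i}) - cs p = s - {i}"
        "as (X - {A (sig i)} - {C i}) = U - {sig i}" by (auto simp: r_def s_def U_def)
      moreover have "p \<subseteq> X - {A (sig i)} - {C i} \<longleftrightarrow> p \<subseteq> X \<and> C i \<notin> p" using pA by blast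
      moreover have "sig i \<in> U \<longleftrightarrow> A (sig i) \<in> X" "i \<in> s \<longleftrightarrow> C i \<in> X \<and> C i \<notin> p"
        by (auto simp: s_def U_def mem_as_bs_cs)
      ultimately show ?thesis unfolding c2_def lead_cond_def Let_def by (simp only:) blast
    qed
    also have "\<dots> \<longleftrightarrow> p \<subseteq> X \<and> r \<inter> s = {} \<and> r \<union> s = insert i f \<and> r \<inter> sig ` s = {} \<and> U = r \<union> sig ` s \<and> i \<in> s"
    proof (cases "i \<in> s \<and> s - {i} \<subseteq> f")
      case True
      hence "sig ` (s - {i}) = sig ` s - {sig i}" "sig i \<in> sig ` s" using inj assms(3) by auto
      moreover have "p \<subseteq> X \<and> j \<in> U \<and> i \<in> s \<and> r \<inter> (s - {i}) = {} \<and> r \<union> (s - {i}) = f \<and>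
          r \<inter> (I - {j}) = {} \<and> U - {j} = r \<union> (I - {j}) \<longleftrightarrow>
          p \<subseteq> X \<and> r \<inter> s = {} \<and> r \<union> s = insert i f \<and> r \<inter> I = {} \<and> U = r \<union> I \<and> i \<in> s"
        if j: "j \<in> I" for j I
      proof (rule iffI; elim conjE)
        assume h: "p \<subseteq> X" "j \<in> U" "r \<inter> (s - {i}) = {}" "r \<union> (s - {i}) = f"
          "r \<inter> (I - {j}) = {}" "U - {j} = r \<union> (I - {j})"
        have "i \<notin> r" using h(4) assms(2) by blast
        moreover have "j \<notin> r" using h(6) by blast
        moreover have "r \<union> s = insert i (r \<union> (s - {i}))" using True by blast
        moreover have "U = insert j (U - {j})" "r \<union> I = insert j (r \<union> (I - {j}))" using h(2) j by blast+
        ultimately show "p \<subseteq> X \<and> r \<inter> s = {} \<and> r \<union> s = insert i f \<and> r \<inter> I = {} \<and> U = r \<union> I \<and> i \<in> s"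
          using h True by (metis Diff_insert0 Int_Diff Int_commute Diff_empty insert_Diff_single)
      next
        assume h: "p \<subseteq> X" "r \<inter> s = {}" "r \<union> s = insert i f" "r \<inter> I = {}" "U = r \<union> I"
        have "i \<notin> r" "j \<notin> r" using h True j by blast+
        hence 1: "r \<union> (s - {i}) = (r \<union> s) - {i}" "U - {j} = r \<union> (I - {j})" using h(5) by blast+
        have "insert i f - {i} = f" using assms(2) by blast
        hence "r \<union> (s - {i}) = f" by (simp only: 1(1) h(3))
        moreover have "r \<inter> (s - {i}) = {}" "r \<inter> (I - {j}) = {}" using h(2,4) by blast+
        moreover have "j \<in> U" "i \<in> s" using h(5) j True by blast+
        ultimately show "p \<subseteq> X \<and> j \<in> U \<and> i \<in> s \<and> r \<inter> (s - {i}) = {} \<and> r \<union> (s - {i}) = f \<and>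
          r \<inter> (I - {j}) = {} \<and> U - {j} = r \<union> (I - {j})"
          using h(1) 1(2) by (intro conjI)
      qed
      ultimately show ?thesis by simp
    qed (use assms(2) in blast)
    finally show ?thesis
      unfolding lead_cond_def Let_def r_def[symmetric] s_def[symmetric] U_def[symmetric] by (simp only: conj_assoc)
  qed
  have ex: "i \<in> r \<longleftrightarrow> i \<notin> s" if "lead_cond p (insert i f) X"
  proof -
    have "r \<inter> s = {}" "r \<union> s = insert i f"
      using that unfolding lead_cond_def Let_def r_def s_def by simp_all
    thus ?thesis by auto
  qed
  have "theta i (Ghat p f) X = (if c1 then 1 else 0) + (if c2 then 1 else 0)"
    unfolding c1_def c2_def by (simp add: theta_def mul_def Ghat_def)
  also have "\<dots> = Ghat p (insert i f) X"
    unfolding c1 c2 Ghat_def using ex by (cases "lead_cond p (insert i f) X"; cases "i \<in> r") simp_all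
  finally show "theta i (Ghat p f) X = Ghat p (insert i f) X" .
qed

lemma theta_Ghat_mem:
  assumes "i \<in> f" "f \<subseteq> {..<t}" "p \<subseteq> BC"
  shows "theta i (Ghat p f) = 0"
proof -
  have "Ghat p f = theta i (Ghat p (f - {i}))"
  proof -
    have "i < t" "i \<notin> f - {i}" "f - {i} \<subseteq> {..<t}" using assms by auto
    from theta_Ghat[OF this assms(3)] show ?thesis using assms(1) by (simp add: insert_absorb)
  qed
  thus ?thesis by (simp add: theta_theta)
qed

lemma finite_BC: "finite BC" by (simp add: BC_def)

lemma S_preserved:
  assumes "G \<in> S n" "\<And>G. G \<in> gens n \<Longrightarrow> g G \<in> S m"
    "\<And>u v. g (u + v) = g u + g v" "\<And>c u. g (\<lambda>x. c * u x) = (\<lambda>x. c * g u x)"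
  shows "g G \<in> S m"
  using assms unfolding S_def by (intro span_preserved[of G "gens n" g "gens m"]) blast+

lemma S_mul: assumes "G \<in> S n" "v \<in> BC" shows "mul v G \<in> S (n + 2)"
proof (rule S_preserved[where g = "mul v", OF assms(1) _ mul_add mul_scale])
  fix G assume "G \<in> gens n"
  then obtain p f where G: "G = Ghat p f" "p \<subseteq> BC" "f \<subseteq> {..<t}" "2 * int (card p) + int (card f) = n"
    unfolding gens_def by blast
  have fin: "finite p" using G(2) finite_BC finite_subset by blast
  have "mul v G = (if v \<in> p then 0 else Ghat (insert v p) f)"
    using assms(2) by (cases v) (auto simp: G(1) mul_B_Ghat mul_C_Ghat)
  moreover have "Ghat (insert v p) f \<in> gens (n + 2)" if "v \<notin> p"
    using G assms(2) that fin unfolding gens_def by (intro CollectI exI[of _ "insert v p"] exI[of _ f]) auto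
  ultimately show "mul v G \<in> S (n + 2)" unfolding S_def using fv.span_zero by (auto intro: fv.span_base)
qed

lemma S_theta: assumes "G \<in> S n" "i < t" shows "theta i G \<in> S (n + 1)"
proof (rule S_preserved[where g = "theta i", OF assms(1) _ theta_add theta_scale])
  fix G assume "G \<in> gens n"
  then obtain p f where G: "G = Ghat p f" "p \<subseteq> BC" "f \<subseteq> {..<t}" "2 * int (card p) + int (card f) = n"
    unfolding gens_def by blast
  have fin: "finite f" using G(3) finite_subset by blast
  show "theta i G \<in> S (n + 1)"
  proof (cases "i \<in> f")
    case True
    thus ?thesis using G theta_Ghat_mem fv.span_zero unfolding S_def by auto
  next
    case False
    have "Ghat p (insert i f) \<in> gens (n + 1)"
      using G assms(2) False fin unfolding gens_def by (intro CollectI exI[of _ "insert i f"] exI[of _ p]) auto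
    thus ?thesis using theta_Ghat[OF assms(2) False G(3,2)] unfolding S_def G(1) by (auto intro: fv.span_base)
  qed
qed

lemma S_add: "G \<in> S n \<Longrightarrow> H \<in> S n \<Longrightarrow> G + H \<in> S n"
  unfolding S_def by (rule fv.span_add)

lemma card_p: assumes "p \<subseteq> BC" shows "card p = card (bs p) + card (cs p)"
proof -
  have "p = B ` bs p \<union> C ` cs p"
  proof (intro equalityI subsetI)
    fix v assume "v \<in> p"
    thus "v \<in> B ` bs p \<union> C ` cs p" using assms by (cases v) (auto simp: mem_as_bs_cs)
  qed (auto simp: mem_as_bs_cs)
  moreover have "finite (bs p)" "finite (cs p)"
    using assms by (auto intro!: finite_subset[of _ "{..<t}"] simp: var_set_subset_iff as_bs_cs_BC)
  ultimately have "card p = card (B ` bs p) + card (C ` cs p)"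
    by (metis (no_types, lifting) card_Un_disjoint disjoint_iff finite_imageI imageE var.distinct(5))
  thus ?thesis by (simp add: card_image inj_on_def)
qed

lemma lead_cond_Var:
  assumes "lead_cond p f X" "p \<subseteq> BC" "f \<subseteq> {..<t}"
  shows "X \<subseteq> Var" "defect X = 2 * int (card p) + int (card f)"
proof -
  define r s where "r = bs X - bs p" and "s = cs X - cs p"
  have h: "p \<subseteq> X" "r \<inter> s = {}" "r \<union> s = f" "r \<inter> sig ` s = {}" "as X = r \<union> sig ` s"
    using assms(1) unfolding lead_cond_def Let_def r_def s_def by blast+
  have p: "bs p \<subseteq> {..<t}" "cs p \<subseteq> {..<t}" "as p = {}"
    using assms(2) by (auto simp: var_set_subset_iff as_bs_cs_BC)
  have sub: "bs p \<subseteq> bs X" "cs p \<subseteq> cs X" using h(1) by (simp_all add: var_set_subset_iff)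
  have rs: "r \<subseteq> {..<t}" "s \<subseteq> {..<t}" using h(3) assms(3) by auto
  have bsX: "bs X = bs p \<union> r" "cs X = cs p \<union> s" using sub unfolding r_def s_def by auto
  show "X \<subseteq> Var" using bsX p rs h(5) sig_less
    by (auto simp: var_set_subset_iff as_bs_cs_Var)
  have fin: "finite (bs p)" "finite (cs p)" "finite r" "finite s" using p rs finite_subset by blast+
  have "card (bs X) = card (bs p) + card r" "card (cs X) = card (cs p) + card s"
  proof -
    have "bs p \<inter> r = {}" "cs p \<inter> s = {}" by (auto simp: r_def s_def)
    thus "card (bs X) = card (bs p) + card r" "card (cs X) = card (cs p) + card s"
      unfolding bsX using fin by (simp_all add: card_Un_disjoint)
  qed
  moreover have "card (as X) = card r + card s"
    unfolding h(5) using fin h(4) card_image[OF inj_on_subset[OF inj_on_sig rs(2)]] by (simp add: card_Un_disjoint)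
  moreover have "card f = card r + card s"
    unfolding h(3)[symmetric] using fin h(2) by (simp add: card_Un_disjoint)
  ultimately show "defect X = 2 * int (card p) + int (card f)"
    unfolding defect_def card_p[OF assms(2)] by simp
qed

lemma S_support:
  assumes "G \<in> S n" "G X \<noteq> 0" shows "X \<subseteq> Var \<and> defect X = n"
proof (rule ccontr)
  assume *: "\<not> ?thesis"
  have "G \<in> {G. G X = 0}"
  proof (rule subsetD[OF fv.span_minimal assms(1)[unfolded S_def]])
    show "gens n \<subseteq> {G. G X = 0}"
    proof
      fix G assume "G \<in> gens n"
      then obtain p f where G: "G = Ghat p f" "p \<subseteq> BC" "f \<subseteq> {..<t}" "2 * int (card p) + int (card f) = n"
        unfolding gens_def by blast
      have "\<not> lead_cond p f X" using lead_cond_Var[OF _ G(2,3)] G(4) * by metis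
      thus "G \<in> {G. G X = 0}" by (simp add: G(1) Ghat_def)
    qed
    show "fv.subspace {G :: var set \<Rightarrow> 'a. G X = 0}"
      unfolding fv.subspace_def by auto
  qed
  thus False using assms(2) by simp
qed

end

section \<open>Leading terms of the code\<close>

context char2_field
begin

text \<open>The coefficient of \<open>Xm q\<close> in \<open>Xm J (b + y)\<close>: by the subset
  expansion it is one monomial in \<open>y\<close> or 0.\<close>

lemma sum_chi_shift:
  assumes "q \<subseteq> {..<t}" "J \<subseteq> {..<t}"
  shows "(\<Sum>b\<in>UNIV. chi q b * Xm J (b + y)) = (if q \<subseteq> J then Xm (J - q) y else 0)"
proof -
  have fin: "finite J" using assms finite_subset by blast
  have "(\<Sum>b\<in>UNIV. chi q b * Xm J (b + y)) = (\<Sum>b\<in>UNIV. \<Sum>r\<in>Pow J. chi q b * Xm r b * Xm (J - r) y)"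
    by (simp add: Xm_add[OF fin] sum_distrib_left mult.assoc)
  also have "\<dots> = (\<Sum>r\<in>Pow J. (\<Sum>b\<in>UNIV. chi q b * Xm r b) * Xm (J - r) y)"
    unfolding sum_distrib_right by (rule sum.swap)
  also have "\<dots> = (\<Sum>r\<in>Pow J. if q = r then Xm (J - r) y else 0)"
    using assms by (intro sum.cong refl) (auto simp: chi_Xm)
  also have "\<dots> = (if q \<subseteq> J then Xm (J - q) y else 0)"
    using fin by simp
  finally show ?thesis .
qed

definition compl :: "nat set \<Rightarrow> nat set" where "compl r = {..<t} - r"

text \<open>\<open>coef X\<close> extracts the coefficient of the monomial with exponents \<open>as X\<close>, \<open>compl (bs X)\<close>,
  \<open>compl (cs X)\<close> in the coordinates \<open>a\<close>, \<open>b\<close>, \<open>c + a * b\<close>; thus multiplication by \<open>B i\<close> or \<open>C i\<close>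
  removes an exponent.\<close>

definition coef :: "var set \<Rightarrow> ('a \<times> 'a \<times> 'a \<Rightarrow> 'a) \<Rightarrow> 'a" where
  "coef X f = (\<Sum>a\<in>UNIV. \<Sum>b\<in>UNIV. \<Sum>c\<in>UNIV.
     chi (as X) a * (chi (compl (bs X)) b * (chi (compl (cs X)) c * f (a, b, c + a * b))))"

lemma coef_add: "coef X (f + g) = coef X f + coef X g"
  by (simp add: coef_def distrib_left sum.distrib)

lemma coef_scale: "coef X (\<lambda>p. k * f p) = k * coef X f"
  by (simp add: coef_def sum_distrib_left mult_ac)

text \<open>Line functions weighted by \<open>chi f x\<close> and monomials in \<open>y\<close> and
  \<open>z\<close>. The lines through \<open>(a, b, c)\<close> are parametrised by \<open>x\<close>,
  with \<open>y = b + a * x\<close> and \<open>z = c + a * b + a ^ 2 * x\<close>. The square of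
  \<open>a\<close> is the origin of the shifted index in \<open>theta\<close>, and the term
  \<open>a * b\<close> is removed by the coordinate change in \<open>coef\<close>.\<close>

definition gfun :: "var set \<Rightarrow> nat set \<Rightarrow> 'a \<times> 'a \<times> 'a \<Rightarrow> 'a" where
  "gfun p f = (\<lambda>(a, b, c). \<Sum>x\<in>UNIV.
     chi f x * (Xm (compl (bs p)) (b + a * x) * Xm (compl (cs p)) (c + a * b + a ^ 2 * x)))"

lemma gfun_code: "gfun p f \<in> fv.span (range line_fun)"
proof -
  have "gfun p f = (\<Sum>x\<in>UNIV. \<Sum>y\<in>UNIV. \<Sum>z\<in>UNIV.
     (\<lambda>q. (chi f x * (Xm (compl (bs p)) y * Xm (compl (cs p)) z)) * line_fun (x, y, z) q))"
  proof
    fix q :: "'a \<times> 'a \<times> 'a"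
    obtain a b c where q: "q = (a, b, c)" by (cases q)
    have line: "line_fun (x, y, z) q = (if y = b + a * x then 1 else 0) * (if z = c + a * b + a ^ 2 * x then 1 else 0)" for x y z
    proof -
      have 1: "b = a * x + y \<longleftrightarrow> y = b + a * x"
        by (metis add.commute add_eq_0 add.assoc)
      have 2: "c = a * (b + a * x) + z \<longleftrightarrow> z = c + a * b + a ^ 2 * x"
        by (metis (no_types, opaque_lifting) add.commute add_eq_0 add.assoc distrib_left power2_eq_square mult.assoc)
      show ?thesis unfolding q line_fun_def using 1 2 by auto
    qed
    have "(\<Sum>y\<in>UNIV. \<Sum>z\<in>UNIV. (k * (Y y * Z z)) * line_fun (x, y, z) q) =
      k * (Y (b + a * x) * Z (c + a * b + a ^ 2 * x))" for x k and Y Z :: "'a \<Rightarrow> 'a"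
    proof -
      have delta: "(\<Sum>y\<in>UNIV. h y * (if y = y0 then 1 else 0)) = h y0" for h :: "'a \<Rightarrow> 'a" and y0
        by (simp add: if_distrib cong: if_cong)
      have "(\<Sum>y\<in>UNIV. \<Sum>z\<in>UNIV. (k * (Y y * Z z)) * line_fun (x, y, z) q) =
        (\<Sum>y\<in>UNIV. (k * Y y) * (if y = b + a * x then 1 else 0)) *
        (\<Sum>z\<in>UNIV. Z z * (if z = c + a * b + a ^ 2 * x then 1 else 0))"
        unfolding sum_product line by (intro sum.cong refl) (simp only: mult_ac)
      thus ?thesis unfolding delta by (simp only: mult.assoc)
    qed
    thus "gfun p f q = (\<Sum>x\<in>UNIV. \<Sum>y\<in>UNIV. \<Sum>z\<in>UNIV.
     (\<lambda>q. (chi f x * (Xm (compl (bs p)) y * Xm (compl (cs p)) z)) * line_fun (x, y, z) q)) q"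
      by (simp only: sum_fun_apply gfun_def q prod.case)
  qed
  also have "\<dots> \<in> fv.span (range line_fun)"
    by (intro fv.span_sum fv.span_scale fv.span_base rangeI)
  finally show ?thesis .
qed

lemma coef_gfun:
  assumes X: "X \<subseteq> Var" and p: "p \<subseteq> BC" and f: "f \<subseteq> {..<t}"
  shows "coef X (gfun p f) = (if p \<subseteq> X \<and> mu (bs X - bs p) (cs X - cs p) = f \<and>
    mu (bs X - bs p) (sig ` (cs X - cs p)) = as X then 1 else 0)"
proof -
  let ?J = "compl (bs p)" and ?K = "compl (cs p)"
  let ?q = "compl (bs X)" and ?q' = "compl (cs X)"
  define r s where "r = bs X - bs p" and "s = cs X - cs p"
  have X': "as X \<subseteq> {..<t}" "bs X \<subseteq> {..<t}" "cs X \<subseteq> {..<t}"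
    using X by (auto simp: var_set_subset_iff as_bs_cs_Var)
  have p': "as p = {}" "bs p \<subseteq> {..<t}" "cs p \<subseteq> {..<t}"
    using p by (auto simp: var_set_subset_iff as_bs_cs_BC)
  have rs: "r \<subseteq> {..<t}" "s \<subseteq> {..<t}" "sig ` s \<subseteq> {..<t}" using X' sig_less by (auto simp: r_def s_def)
  have sub: "?q \<subseteq> {..<t}" "?J \<subseteq> {..<t}" "?q' \<subseteq> {..<t}" "?K \<subseteq> {..<t}" by (auto simp: compl_def)
  have J: "?J - ?q = r" "?K - ?q' = s" using X' by (auto simp: compl_def r_def s_def)
  have pX: "p \<subseteq> X \<longleftrightarrow> ?q \<subseteq> ?J \<and> ?q' \<subseteq> ?K"
    using p' X' by (auto simp: var_set_subset_iff compl_def)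
  have shift: "c + a * b + a * b + y = c + y" for a b c y :: 'a by (simp add: add.assoc add_self)
  have "coef X (gfun p f) = (\<Sum>a\<in>UNIV. \<Sum>b\<in>UNIV. \<Sum>c\<in>UNIV. \<Sum>x\<in>UNIV.
      chi (as X) a * chi f x * ((chi ?q b * Xm ?J (b + a * x)) * (chi ?q' c * Xm ?K (c + a ^ 2 * x))))"
    unfolding coef_def gfun_def prod.case shift sum_distrib_left
    by (intro sum.cong refl) (simp only: mult_ac)
  also have "\<dots> = (\<Sum>a\<in>UNIV. \<Sum>x\<in>UNIV. \<Sum>b\<in>UNIV. \<Sum>c\<in>UNIV.
      chi (as X) a * chi f x * ((chi ?q b * Xm ?J (b + a * x)) * (chi ?q' c * Xm ?K (c + a ^ 2 * x))))"
  proof (rule sum.cong[OF refl])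
    fix a :: 'a
    let ?f = "\<lambda>b c x. chi (as X) a * chi f x * ((chi ?q b * Xm ?J (b + a * x)) * (chi ?q' c * Xm ?K (c + a ^ 2 * x)))"
    have "(\<Sum>b\<in>UNIV. \<Sum>c\<in>UNIV. \<Sum>x\<in>UNIV. ?f b c x) = (\<Sum>b\<in>UNIV. \<Sum>x\<in>UNIV. \<Sum>c\<in>UNIV. ?f b c x)"
      by (rule sum.cong[OF refl], rule sum.swap)
    thus "(\<Sum>b\<in>UNIV. \<Sum>c\<in>UNIV. \<Sum>x\<in>UNIV. ?f b c x) = (\<Sum>x\<in>UNIV. \<Sum>b\<in>UNIV. \<Sum>c\<in>UNIV. ?f b c x)"
      by (simp only: sum.swap[of "\<lambda>b x. \<Sum>c\<in>UNIV. ?f b c x"])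
  qed
  also have "\<dots> = (\<Sum>a\<in>UNIV. \<Sum>x\<in>UNIV. chi (as X) a * chi f x *
      ((\<Sum>b\<in>UNIV. chi ?q b * Xm ?J (b + a * x)) * (\<Sum>c\<in>UNIV. chi ?q' c * Xm ?K (c + a ^ 2 * x))))"
    unfolding sum_product by (simp only: sum_distrib_left)
  also have "\<dots> = (\<Sum>a\<in>UNIV. \<Sum>x\<in>UNIV. if p \<subseteq> X then
      (chi (as X) a * Xm (mu r (sig ` s)) a) * (chi f x * Xm (mu r s) x) else 0)"
  proof (intro sum.cong refl)
    fix a x :: 'a
    have "Xm r (a * x) * Xm s (a ^ 2 * x) = (Xm r a * Xm (sig ` s) a) * (Xm r x * Xm s x)"
      by (simp add: Xm_mult Xm_square[OF rs(2)] mult_ac)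
    also have "\<dots> = Xm (mu r (sig ` s)) a * Xm (mu r s) x"
      using rs by (simp add: Xm_times)
    finally have *: "Xm r (a * x) * Xm s (a ^ 2 * x) = Xm (mu r (sig ` s)) a * Xm (mu r s) x" .
    show "chi (as X) a * chi f x *
      ((\<Sum>b\<in>UNIV. chi ?q b * Xm ?J (b + a * x)) * (\<Sum>c\<in>UNIV. chi ?q' c * Xm ?K (c + a ^ 2 * x))) =
      (if p \<subseteq> X then (chi (as X) a * Xm (mu r (sig ` s)) a) * (chi f x * Xm (mu r s) x) else 0)"
    proof (cases "p \<subseteq> X")
      case True
      hence "?q \<subseteq> ?J" "?q' \<subseteq> ?K" using pX by auto
      thus ?thesis using True * by (simp add: sum_chi_shift sub J mult_ac)
    next
      case False
      hence "\<not> ?q \<subseteq> ?J \<or> \<not> ?q' \<subseteq> ?K" using pX by auto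
      thus ?thesis using False by (auto simp: sum_chi_shift sub)
    qed
  qed
  also have "\<dots> = (if p \<subseteq> X then (\<Sum>a\<in>UNIV. chi (as X) a * Xm (mu r (sig ` s)) a) *
      (\<Sum>x\<in>UNIV. chi f x * Xm (mu r s) x) else 0)"
    by (simp add: sum_product)
  also have "\<dots> = (if p \<subseteq> X \<and> mu r s = f \<and> mu r (sig ` s) = as X then 1 else 0)"
    using chi_Xm[OF X'(1) mu_subset[OF rs(1,3)]] chi_Xm[OF f mu_subset[OF rs(1,2)]] by auto
  finally show ?thesis unfolding r_def s_def .
qed

text \<open>The sets \<open>f\<close> and \<open>as X\<close> have at most
  \<open>card r + card s\<close> elements, with a strict inequality as soon as digits collide. The
  bound on the defect forces equality in both, hence no carries, and \<open>mu\<close> becomes the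
  disjoint union demanded by \<open>lead_cond\<close>.\<close>

lemma coef_gfun_lead:
  assumes X: "X \<subseteq> Var" and p: "p \<subseteq> BC" and f: "f \<subseteq> {..<t}"
    and le: "defect X \<le> 2 * int (card p) + int (card f)"
  shows "coef X (gfun p f) = Ghat p f X"
proof (cases "p \<subseteq> X")
  case False
  thus ?thesis using coef_gfun[OF X p f] by (simp add: Ghat_def lead_cond_def)
next
  case True
  define r s where "r = bs X - bs p" and "s = cs X - cs p"
  have X': "bs X \<subseteq> {..<t}" "cs X \<subseteq> {..<t}"
    using X by (auto simp: var_set_subset_iff as_bs_cs_Var)
  have rs: "r \<subseteq> {..<t}" "s \<subseteq> {..<t}" "sig ` s \<subseteq> {..<t}" using X' sig_less by (auto simp: r_def s_def)
  have fin: "finite (bs X)" "finite (cs X)" using X' finite_subset by blast+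
  have "bs p \<subseteq> bs X" "cs p \<subseteq> cs X" using True by (simp_all add: var_set_subset_iff)
  hence "card (bs X) = card (bs p) + card r" "card (cs X) = card (cs p) + card s"
    using fin by (simp_all add: r_def s_def card_Diff_subset finite_subset card_mono)
  hence d: "defect X = 2 * int (card p) + 2 * int (card r + card s) - int (card (as X))"
    by (simp add: defect_def card_p[OF p])
  have cs: "card (sig ` s) = card s" by (rule card_image[OF inj_on_subset[OF inj_on_sig rs(2)]])
  have "mu r s = f \<and> mu r (sig ` s) = as X \<longleftrightarrow>
      r \<inter> s = {} \<and> r \<union> s = f \<and> r \<inter> sig ` s = {} \<and> as X = r \<union> sig ` s"
  proof
    assume *: "mu r s = f \<and> mu r (sig ` s) = as X"
    have "card f \<le> card r + card s" "card (as X) \<le> card r + card s"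
      using card_mu_le[OF rs(1,2)] card_mu_le[OF rs(1,3)] * cs by simp_all
    hence "card f = card r + card s \<and> card (as X) = card r + card s" using le d by simp
    hence "r \<inter> s = {}" "r \<inter> sig ` s = {}"
      using card_mu_less[OF rs(1,2)] card_mu_less[OF rs(1,3)] * cs by (metis less_irrefl)+
    thus "r \<inter> s = {} \<and> r \<union> s = f \<and> r \<inter> sig ` s = {} \<and> as X = r \<union> sig ` s"
      using mu_disjoint[OF rs(1,2)] mu_disjoint[OF rs(1,3)] * by simp
  next
    assume "r \<inter> s = {} \<and> r \<union> s = f \<and> r \<inter> sig ` s = {} \<and> as X = r \<union> sig ` s"
    thus "mu r s = f \<and> mu r (sig ` s) = as X"
      using mu_disjoint[OF rs(1,2)] mu_disjoint[OF rs(1,3)] by simp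
  qed
  thus ?thesis using True coef_gfun[OF X p f]
    unfolding Ghat_def lead_cond_def Let_def r_def s_def by simp
qed

text \<open>By \<open>S_support\<close>, \<open>G\<close> vanishes in all other degrees, so this
  exhibits \<open>G\<close> as the lowest homogeneous component of an element of the code.\<close>

lemma S_lift:
  assumes "G \<in> S n"
  shows "\<exists>g \<in> fv.span (range line_fun). \<forall>X \<subseteq> Var. defect X \<le> n \<longrightarrow> coef X g = G X"
proof -
  let ?T = "{G. \<exists>g \<in> fv.span (range line_fun). \<forall>X \<subseteq> Var. defect X \<le> n \<longrightarrow> coef X g = G X}"
  have "fv.subspace ?T"
    unfolding fv.subspace_def
  proof (intro conjI ballI allI)
    have "coef X 0 = 0" for X by (simp add: coef_def)
    thus "0 \<in> ?T" using fv.span_zero[of "range line_fun"] by (intro CollectI bexI[of _ 0]) auto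
  next
    fix G H assume "G \<in> ?T" "H \<in> ?T"
    then obtain g h where gh: "g \<in> fv.span (range line_fun)" "h \<in> fv.span (range line_fun)"
      "\<forall>X \<subseteq> Var. defect X \<le> n \<longrightarrow> coef X g = G X" "\<forall>X \<subseteq> Var. defect X \<le> n \<longrightarrow> coef X h = H X" by blast
    thus "G + H \<in> ?T"
      by (intro CollectI bexI[of _ "g + h"]) (auto simp: coef_add fv.span_add)
  next
    fix k G assume "G \<in> ?T"
    then obtain g where "g \<in> fv.span (range line_fun)"
      "\<forall>X \<subseteq> Var. defect X \<le> n \<longrightarrow> coef X g = G X" by blast
    thus "(\<lambda>X. k * G X) \<in> ?T"
      by (intro CollectI bexI[of _ "\<lambda>q. k * g q"]) (auto simp: coef_scale fv.span_scale)
  qed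
  moreover have "gens n \<subseteq> ?T"
  proof
    fix G assume "G \<in> gens n"
    then obtain p f where "G = Ghat p f" "p \<subseteq> BC" "f \<subseteq> {..<t}" "2 * int (card p) + int (card f) = n"
      unfolding gens_def by blast
    thus "G \<in> ?T" using coef_gfun_lead gfun_code by (intro CollectI bexI[of _ "gfun p f"]) auto
  qed
  ultimately have "S n \<subseteq> ?T" unfolding S_def by (intro fv.span_minimal)
  thus ?thesis using assms by blast
qed

end

section \<open>The lower bound\<close>

text \<open>A letter records which of \<open>A (sig i)\<close>, \<open>B i\<close>, \<open>C i\<close> occur at digit \<open>i\<close>; words are read from the
  right, and \<open>accepts ls s s'\<close> means that state \<open>s\<close> at the right end leads to \<open>s'\<close> at the left end.\<close>

type_synonym letter = "bool \<times> bool \<times> bool"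

fun letters :: "bool \<Rightarrow> bool \<Rightarrow> letter set" where
  "letters False False = {(False, False, False), (False, True, False), (False, False, True),
     (True, False, True), (True, True, True)}"
| "letters False True = {(False, True, True)}"
| "letters True False = {(False, False, False), (True, False, False), (False, False, True), (True, False, True)}"
| "letters True True = {(False, True, False), (False, True, True), (True, True, False), (True, True, True)}"

fun accepts :: "letter list \<Rightarrow> bool \<Rightarrow> bool \<Rightarrow> bool" where
  "accepts [] s s' \<longleftrightarrow> s = s'"
| "accepts (l # ls) s s' \<longleftrightarrow> (\<exists>m. accepts ls s m \<and> l \<in> letters m s')"

lemma accepts_append: "accepts (ls @ ls') s s' \<longleftrightarrow> (\<exists>m. accepts ls' s m \<and> accepts ls m s')"
  by (induction ls arbitrary: s') auto

text \<open>The automaton is deterministic, so that counting accepted words amounts to counting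
  paths.\<close>

lemma letters_disjoint: "l \<in> letters m s \<Longrightarrow> l \<in> letters m s' \<Longrightarrow> s = s'"
  by (cases m; cases s; cases s') auto

lemma accepts_unique: "accepts ls s s1 \<Longrightarrow> accepts ls s s2 \<Longrightarrow> s1 = s2"
proof (induction ls arbitrary: s1 s2)
  case (Cons l ls)
  then obtain m1 m2 where m: "accepts ls s m1" "l \<in> letters m1 s1" "accepts ls s m2" "l \<in> letters m2 s2"
    by auto
  hence "m1 = m2" by (intro Cons.IH)
  thus ?case using letters_disjoint m(2,4) by blast
qed simp

lemma card_letters: "card (letters False False) = 5" "card (letters False True) = 1"
    "card (letters True False) = 4" "card (letters True True) = 4"
  by simp_all

section \<open>Counting accepted words\<close>

definition accepted :: "nat \<Rightarrow> bool \<Rightarrow> bool \<Rightarrow> letter list set" where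
  "accepted n s s' = {ls. length ls = n \<and> accepts ls s s'}"

lemma accepted_Suc:
  "accepted (Suc n) s s' = (\<lambda>(l, ls). l # ls) `
    (letters False s' \<times> accepted n s False \<union> letters True s' \<times> accepted n s True)"
proof (intro equalityI subsetI)
  fix ls assume "ls \<in> accepted (Suc n) s s'"
  then obtain l ls' m where ls: "ls = l # ls'" "length ls' = n" "accepts ls' s m" "l \<in> letters m s'"
    by (auto simp: accepted_def length_Suc_conv)
  hence "(l, ls') \<in> letters False s' \<times> accepted n s False \<union> letters True s' \<times> accepted n s True"
    by (cases m) (auto simp: accepted_def)
  thus "ls \<in> (\<lambda>(l, ls). l # ls) `
    (letters False s' \<times> accepted n s False \<union> letters True s' \<times> accepted n s True)"
    unfolding ls(1) by (intro image_eqI[of _ _ "(l, ls')"]) auto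
qed (auto simp: accepted_def)

lemma finite_accepted: "finite (accepted n s s')"
proof -
  have "finite {ls :: letter list. set ls \<subseteq> UNIV \<and> length ls = n}" by (rule finite_lists_length_eq) simp
  thus ?thesis by (rule rev_finite_subset) (auto simp: accepted_def)
qed

lemma card_accepted: "card (accepted n s s') = paths n s s'"
proof (induction n arbitrary: s')
  case 0
  have "accepted 0 s s' = (if s = s' then {[]} else {})" by (auto simp: accepted_def)
  thus ?case by simp
next
  case (Suc n)
  let ?U = "letters False s' \<times> accepted n s False" and ?V = "letters True s' \<times> accepted n s True"
  have fin: "finite (letters m s')" for m by (cases m; cases s') simp_all
  have "card (accepted (Suc n) s s') = card (?U \<union> ?V)"
    unfolding accepted_Suc by (rule card_image) (auto simp: inj_on_def)
  also have "\<dots> = card ?U + card ?V"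
  proof (rule card_Un_disjoint)
    show "?U \<inter> ?V = {}" using accepts_unique by (fastforce simp: accepted_def)
  qed (auto simp: fin finite_accepted)
  also have "\<dots> = paths (Suc n) s s'"
    by (cases s') (simp_all only: card_cartesian_product Suc card_letters paths.simps)
  finally show ?case .
qed

text \<open>Runs from the two states merge, or one of them dies, at every letter except
  \<open>b\<close> and \<open>abc\<close>, which preserve both states. Thus at most
  \<open>2 ^ n\<close> words are accepted cyclically in both states.\<close>

lemma accepts_both:
  assumes "accepts ls False s1" "accepts ls True s2" "s1 \<noteq> s2"
  shows "set ls \<subseteq> {(False, True, False), (True, True, True)} \<and> \<not> s1 \<and> s2"
  using assms
proof (induction ls arbitrary: s1 s2)
  case (Cons l ls)
  then obtain m1 m2 where m: "accepts ls False m1" "l \<in> letters m1 s1" "accepts ls True m2" "l \<in> letters m2 s2"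
    by auto
  have "m1 \<noteq> m2" using m letters_disjoint Cons.prems(3) by blast
  hence "set ls \<subseteq> {(False, True, False), (True, True, True)}" "\<not> m1" "m2" using Cons.IH[OF m(1,3)] by auto
  thus ?case using m(2,4) Cons.prems(3) by (cases s1; cases s2) auto
qed simp

definition good_words :: "nat \<Rightarrow> letter list set" where
  "good_words n = {ls. length ls = n \<and> (accepts ls False False \<or>
     (accepts ls True True \<and> (\<exists>(a, b, c) \<in> set ls. \<not> b \<or> c)))}"

lemma card_lists2: "x \<noteq> y \<Longrightarrow> card {ls. set ls \<subseteq> {x, y} \<and> length ls = n} = 2 ^ n"
  by (subst card_lists_length_eq) (simp_all add: numeral_2_eq_2)

lemma card_good:
  "paths n False False + paths n True True \<le> card (good_words n) + 2 ^ n + (2 ^ n - 1)"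
proof -
  let ?A = "accepted n False False" and ?B = "accepted n True True"
  let ?b = "(False, True, False) :: letter"
  let ?L = "\<lambda>x. {ls. set ls \<subseteq> {?b, x} \<and> length ls = n}"
  have finL: "finite (?L x)" for x by (rule finite_lists_length_eq) simp
  have "?A \<inter> ?B \<subseteq> ?L (True, True, True)"
    using accepts_both by (fastforce simp: accepted_def)
  moreover have "card (?L (True, True, True)) = 2 ^ n" by (rule card_lists2) simp
  ultimately have "card (?A \<inter> ?B) \<le> 2 ^ n"
    using card_mono[OF finL, of "?A \<inter> ?B" "(True, True, True)"] by simp
  hence 1: "paths n False False + paths n True True \<le> card (?A \<union> ?B) + 2 ^ n"
    using card_Un_Int[OF finite_accepted finite_accepted, of n False False n True True]
    by (simp add: card_accepted)
  have "accepts (replicate k ?b) False False" for k by (induction k) auto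
  hence rep: "replicate n ?b \<in> good_words n" unfolding good_words_def by simp
  have "?A \<union> ?B \<subseteq> good_words n \<union> (?L (True, True, False) - {replicate n ?b})"
  proof
    fix ls assume ls: "ls \<in> ?A \<union> ?B"
    show "ls \<in> good_words n \<union> (?L (True, True, False) - {replicate n ?b})"
    proof (cases "ls \<in> good_words n")
      case False
      hence "accepts ls True True" "\<forall>(a, b, c) \<in> set ls. b \<and> \<not> c" "length ls = n"
        using ls by (auto simp: accepted_def good_words_def)
      moreover from this have "set ls \<subseteq> {?b, (True, True, False)}" by auto
      ultimately show ?thesis using False rep by auto
    qed simp
  qed
  hence "card (?A \<union> ?B) \<le> card (good_words n \<union> (?L (True, True, False) - {replicate n ?b}))"
  proof (rule card_mono[rotated])
    have "finite (good_words n)"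
      by (rule finite_subset[of _ "?A \<union> ?B"]) (auto simp: good_words_def accepted_def intro: finite_accepted[unfolded accepted_def])
    thus "finite (good_words n \<union> (?L (True, True, False) - {replicate n ?b}))" using finL by blast
  qed
  also have "\<dots> \<le> card (good_words n) + card (?L (True, True, False) - {replicate n ?b})"
    by (rule card_Un_le)
  also have "card (?L (True, True, False) - {replicate n ?b}) = 2 ^ n - 1"
  proof (subst card_Diff_singleton)
    show "replicate n ?b \<in> ?L (True, True, False)" by auto
  qed (simp add: card_lists2)
  finally show ?thesis using 1 by linarith
qed

context char2_field
begin

section \<open>Leading monomials described by words\<close>

fun lvars :: "nat \<Rightarrow> letter \<Rightarrow> var set" where
  "lvars i (a, b, c) = (if a then {A (sig i)} else {}) \<union> (if b then {B i} else {}) \<union> (if c then {C i} else {})"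

fun wvars :: "nat \<Rightarrow> letter list \<Rightarrow> var set" where
  "wvars i [] = {}"
| "wvars i (l # ls) = lvars i l \<union> wvars (Suc i) ls"

lemma wvars_append: "wvars i (ls @ ls') = wvars i ls \<union> wvars (i + length ls) ls'"
  by (induction ls arbitrary: i) auto

text \<open>\<open>A (sig i)\<close> is assigned to digit \<open>i\<close>, where it accompanies
  \<open>C i\<close> in \<open>theta i\<close>. The other variable \<open>A i\<close> of
  \<open>theta i\<close> then belongs to the digit that is read next.\<close>

definition dvars :: "nat \<Rightarrow> var set" where "dvars i = {A (sig i), B i, C i}"

lemma lvars_dvars: "lvars i l \<subseteq> dvars i" by (cases l) (auto simp: dvars_def)

lemma wvars_dvars: "wvars i ls \<subseteq> (\<Union>j\<in>{i..<i + length ls}. dvars j)"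
proof (induction ls arbitrary: i)
  case (Cons l ls)
  have "lvars i l \<subseteq> (\<Union>j\<in>{i..<i + length (l # ls)}. dvars j)" using lvars_dvars[of i l] by force
  moreover have "(\<Union>j\<in>{Suc i..<Suc i + length ls}. dvars j) \<subseteq> (\<Union>j\<in>{i..<i + length (l # ls)}. dvars j)"
    by (intro UN_mono) auto
  ultimately show ?case using Cons[of "Suc i"] by auto
qed simp

lemma dvars_disjoint: "i < t \<Longrightarrow> j < t \<Longrightarrow> i \<noteq> j \<Longrightarrow> dvars i \<inter> dvars j = {}"
  using inj_on_sig by (auto simp: dvars_def dest: inj_onD)

lemma wvars_disjoint:
  assumes "i + length ls \<le> t" "j < t" "j < i \<or> i + length ls \<le> j"
  shows "wvars i ls \<inter> dvars j = {}"
proof -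
  have "dvars k \<inter> dvars j = {}" if "k \<in> {i..<i + length ls}" for k
    using that assms by (intro dvars_disjoint) auto
  thus ?thesis using wvars_dvars[of i ls] by blast
qed

lemma wvars_inj:
  assumes "wvars i ls = wvars i ls'" "length ls = length ls'" "i + length ls \<le> t"
  shows "ls = ls'"
  using assms
proof (induction ls arbitrary: i ls')
  case (Cons l ls)
  then obtain l' ls2 where ls': "ls' = l' # ls2" by (cases ls') auto
  have dis: "dvars i \<inter> wvars (Suc i) u = {}" if "length u = length ls" for u
    using wvars_disjoint[of "Suc i" u i] Cons.prems(3) that by (simp add: Int_commute)
  have e1: "lvars i l = wvars i (l # ls) \<inter> dvars i" using dis[of ls] lvars_dvars[of i l] by auto
  have e2: "lvars i l' = wvars i (l' # ls2) \<inter> dvars i"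
    using dis[of ls2] lvars_dvars[of i l'] Cons.prems(2) ls' by auto
  have e3: "wvars (Suc i) ls = wvars i (l # ls) - dvars i" using dis[of ls] lvars_dvars[of i l] by auto
  have e4: "wvars (Suc i) ls2 = wvars i (l' # ls2) - dvars i"
    using dis[of ls2] lvars_dvars[of i l'] Cons.prems(2) ls' by auto
  have "lvars i l = lvars i l'" using e1 e2 Cons.prems(1) ls' by simp
  hence "l = l'" by (cases l; cases l') (auto split: if_splits)
  moreover have "wvars (Suc i) ls = wvars (Suc i) ls2" using e3 e4 Cons.prems(1) ls' by simp
  hence "ls = ls2" using Cons.IH[of "Suc i" ls2] Cons.prems(2,3) ls' by simp
  ultimately show ?case using ls' by simp
qed simp

text \<open>Monomials are compared by their number of \<open>C\<close> variables only, and the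
  leading one must have strictly more than all others. In \<open>theta i\<close> the term
  \<open>a_(i+1) c_i\<close> leads.\<close>

definition lead :: "var set \<Rightarrow> (var set \<Rightarrow> 'a) \<Rightarrow> bool" where
  "lead X e \<longleftrightarrow> finite X \<and> e X = 1 \<and> (\<forall>Y. e Y \<noteq> 0 \<longrightarrow> Y = X \<or> card (cs Y) < card (cs X))"

lemma finite_cs: "finite X \<Longrightarrow> finite (cs X)"
  unfolding cs_def using finite_vimageI[of X C] by (simp add: vimage_def inj_def)

lemma lead_mul:
  assumes "lead X e" "v \<notin> X"
  shows "lead (insert v X) (mul v e)"
  unfolding lead_def
proof (intro conjI allI impI)
  show "finite (insert v X)" "mul v e (insert v X) = 1"
    using assms by (auto simp: lead_def mul_def)
next
  fix Y assume "mul v e Y \<noteq> 0"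
  hence Y: "v \<in> Y" "e (Y - {v}) \<noteq> 0" by (auto simp: mul_def split: if_splits)
  hence "Y - {v} = X \<or> card (cs (Y - {v})) < card (cs X)" using assms by (auto simp: lead_def)
  thus "Y = insert v X \<or> card (cs Y) < card (cs (insert v X))"
  proof
    assume *: "card (cs (Y - {v})) < card (cs X)"
    have fin: "finite (cs X)" using assms finite_cs by (auto simp: lead_def)
    show ?thesis
    proof (cases v)
      case (C i)
      have "card (insert i I) \<le> Suc (card I)" for I :: "nat set"
        by (cases "finite I") (simp_all add: card_insert_if)
      moreover have "cs Y = insert i (cs (Y - {v}))" using Y(1) C by (auto simp: cs_def)
      ultimately have "card (cs Y) \<le> Suc (card (cs (Y - {v})))" by metis
      moreover have "card (cs (insert v X)) = Suc (card (cs X))"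
        using C assms(2) fin by (simp add: mem_as_bs_cs)
      ultimately show ?thesis using * by linarith
    qed (use * in auto)
  qed (use Y in auto)
qed

lemma lead_theta:
  assumes "lead X e" "A (sig i) \<notin> X" "B i \<notin> X" "C i \<notin> X"
  shows "lead (insert (A (sig i)) (insert (C i) X)) (theta i e)"
proof -
  let ?X = "insert (A (sig i)) (insert (C i) X)"
  have l: "lead ?X (mul (A (sig i)) (mul (C i) e))"
    using assms by (intro lead_mul) auto
  have fin: "finite (cs X)" using assms finite_cs by (auto simp: lead_def)
  have c: "card (cs ?X) = Suc (card (cs X))" using assms(4) fin by (simp add: mem_as_bs_cs)
  show ?thesis
    unfolding lead_def
  proof (intro conjI allI impI)
    show "finite ?X" using l by (simp add: lead_def)
    show "theta i e ?X = 1" using l assms(3) by (simp add: theta_def lead_def mul_def)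
  next
    fix Y assume "theta i e Y \<noteq> 0"
    then consider "mul (A i) (mul (B i) e) Y \<noteq> 0" | "mul (A (sig i)) (mul (C i) e) Y \<noteq> 0"
      unfolding theta_def by fastforce
    thus "Y = ?X \<or> card (cs Y) < card (cs ?X)"
    proof cases
      case 1
      hence "e (Y - {A i} - {B i}) \<noteq> 0" by (auto simp: mul_def split: if_splits)
      hence "Y - {A i} - {B i} = X \<or> card (cs (Y - {A i} - {B i})) < card (cs X)"
        using assms(1) by (auto simp: lead_def)
      moreover have "cs (Y - {A i} - {B i}) = cs Y" by simp
      ultimately have "card (cs Y) \<le> card (cs X)" by fastforce
      thus ?thesis using c by simp
    next
      case 2
      thus ?thesis using l by (auto simp: lead_def)
    qed
  qed
qed

text \<open>The meaning of the states: \<open>A k\<close> itself is not in the subalgebra, but in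
  state \<open>True\<close> its product with \<open>e\<close> is, in degree one lower.\<close>

definition adm :: "bool \<Rightarrow> nat \<Rightarrow> var set \<Rightarrow> (var set \<Rightarrow> 'a) \<Rightarrow> bool" where
  "adm s k X e \<longleftrightarrow> lead X e \<and> (\<exists>n. e \<in> S n \<and> (s \<longrightarrow> mul (A k) e \<in> S (n - 1)))"

lemma S_cong: "G \<in> S n \<Longrightarrow> n = m \<Longrightarrow> G \<in> S m" by simp

lemma admI:
  assumes "lead X e" "e \<in> S n" "s \<Longrightarrow> mul (A k) e \<in> S m" "m = n - 1"
  shows "adm s k X e"
  using assms unfolding adm_def by blast

lemma adm_False: "lead X e \<Longrightarrow> e \<in> S n \<Longrightarrow> adm False k X e"
  unfolding adm_def by blast

text \<open>From \<open>False\<close> the letters are realised by the factors \<open>1\<close>,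
  \<open>b_i\<close>, \<open>c_i\<close>, \<open>theta_i\<close>, \<open>b_i theta_i\<close> and,
  going to \<open>True\<close>, by \<open>b_i c_i\<close>, since
  \<open>a_i b_i c_i = c_i theta_i\<close>. In state \<open>True\<close> also
  \<open>a_(i+1) e\<close> is available. There \<open>b_i\<close> preserves the state because
  \<open>a_i b_i = theta_i + a_(i+1) c_i\<close>, and \<open>a_(i+1) b_i\<close> does because
  \<open>a_i b_i a_(i+1) = theta_i a_(i+1)\<close>.\<close>

lemma adm_step:
  assumes adm: "adm s (sig i) X e" and i: "i < t" and l: "l \<in> letters s s'" and dis: "X \<inter> dvars i = {}"
  shows "\<exists>e'. adm s' i (X \<union> lvars i l) e'"
proof -
  obtain n where n: "lead X e" "e \<in> S n" "s \<Longrightarrow> mul (A (sig i)) e \<in> S (n - 1)"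
    using adm unfolding adm_def by blast
  have fresh: "A (sig i) \<notin> X" "B i \<notin> X" "C i \<notin> X" using dis by (auto simp: dvars_def)
  have BC: "B i \<in> BC" "C i \<in> BC" using i by simp_all
  let ?a = "mul (A (sig i))" and ?b = "mul (B i)" and ?c = "mul (C i)"
  have lb: "lead (insert (B i) X) (?b e)" and lc: "lead (insert (C i) X) (?c e)"
    and la: "lead (insert (A (sig i)) X) (?a e)"
    using fresh by (auto intro!: lead_mul n)
  have lac: "lead (insert (A (sig i)) (insert (C i) X)) (?a (?c e))"
    and lbc: "lead (insert (B i) (insert (C i) X)) (?b (?c e))"
    using fresh by (auto intro!: lead_mul n)
  have Sab: "mul (A i) (?b e) \<in> S (n + 1)" if s
  proof -
    have "?c (?a e) \<in> S (n + 1)" by (rule S_cong[OF S_mul[OF n(3)[OF that] BC(2)]]) simp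
    thus ?thesis unfolding mul_AB using S_theta[OF n(2) i] by (rule S_add[rotated])
  qed
  have Sabc: "mul (A i) (?b (?c e)) \<in> S (n + 3)"
    unfolding mul_C_theta[symmetric] by (rule S_cong[OF S_mul[OF S_theta[OF n(2) i] BC(2)]]) simp
  consider (e) "l = (False, False, False)" "s' = False"
    | (b) "l = (False, True, False)" "s' = s"
    | (c) "l = (False, False, True)" "s' = False"
    | (ac) "l = (True, False, True)" "s' = False" "\<not> s"
    | (abc) "l = (True, True, True)" "s' = False" "\<not> s"
    | (bc) "l = (False, True, True)" "s'"
    | (a) "l = (True, False, False)" "s' = False" "s"
    | (ac') "l = (True, False, True)" "s' = False" "s"
    | (ab) "l = (True, True, False)" "s'" "s"
    | (abc') "l = (True, True, True)" "s'" "s"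
    using l by (cases s; cases s') auto
  thus ?thesis
  proof cases
    case e
    thus ?thesis using adm_False[OF n(1,2)] by auto
  next
    case b
    have "adm s' i (insert (B i) X) (?b e)"
      by (rule admI[OF lb S_mul[OF n(2) BC(1)], of _ _ "n + 1"]) (use Sab b in auto)
    thus ?thesis using b by auto
  next
    case c
    have "adm s' i (insert (C i) X) (?c e)"
      unfolding c(2) by (rule adm_False[OF lc S_mul[OF n(2) BC(2)]])
    thus ?thesis using c by auto
  next
    case ac
    have "adm s' i (insert (A (sig i)) (insert (C i) X)) (theta i e)"
      unfolding ac(2) by (rule adm_False[OF lead_theta[OF n(1) fresh] S_theta[OF n(2) i]])
    thus ?thesis using ac by (auto simp: insert_commute)
  next
    case abc
    have "lead (insert (B i) (insert (A (sig i)) (insert (C i) X))) (?b (theta i e))"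
      unfolding mul_B_theta using fresh by (intro lead_mul lac) auto
    hence "adm s' i (insert (B i) (insert (A (sig i)) (insert (C i) X))) (?b (theta i e))"
      unfolding abc(2) by (rule adm_False[OF _ S_mul[OF S_theta[OF n(2) i] BC(1)]])
    thus ?thesis using abc by (auto simp: insert_commute)
  next
    case bc
    have "adm s' i (insert (B i) (insert (C i) X)) (?b (?c e))"
      by (rule admI[OF lbc S_mul[OF S_mul[OF n(2) BC(2)] BC(1)] Sabc]) auto
    thus ?thesis using bc by (auto simp: insert_commute)
  next
    case a
    have "adm s' i (insert (A (sig i)) X) (?a e)"
      unfolding a(2) by (rule adm_False[OF la n(3)[OF a(3)]])
    thus ?thesis using a by auto
  next
    case ac'
    have "lead (insert (C i) (insert (A (sig i)) X)) (?c (?a e))"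
      using fresh by (intro lead_mul la) auto
    hence "adm s' i (insert (C i) (insert (A (sig i)) X)) (?c (?a e))"
      unfolding ac'(2) by (rule adm_False[OF _ S_mul[OF n(3)[OF ac'(3)] BC(2)]])
    thus ?thesis using ac' by (auto simp: insert_commute)
  next
    case ab
    have "lead (insert (B i) (insert (A (sig i)) X)) (?b (?a e))"
      using fresh by (intro lead_mul la) auto
    moreover have "?b (?a e) \<in> S (n + 1)" by (rule S_cong[OF S_mul[OF n(3)[OF ab(3)] BC(1)]]) simp
    moreover have "mul (A i) (?b (?a e)) \<in> S n"
      unfolding theta_mul_A[symmetric] by (rule S_cong[OF S_theta[OF n(3)[OF ab(3)] i]]) simp
    ultimately have "adm s' i (insert (B i) (insert (A (sig i)) X)) (?b (?a e))"
      by (intro admI[of _ _ "n + 1"]) auto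
    thus ?thesis using ab by (auto simp: insert_commute)
  next
    case abc'
    have "lead (insert (C i) (insert (B i) (insert (A (sig i)) X))) (?c (?b (?a e)))"
      using fresh by (intro lead_mul la) auto
    moreover have "?b (?a e) \<in> S (n + 1)" by (rule S_cong[OF S_mul[OF n(3)[OF abc'(3)] BC(1)]]) simp
    hence "?c (?b (?a e)) \<in> S (n + 3)" by (rule S_cong[OF S_mul[OF _ BC(2)]]) simp
    moreover have eq: "mul (A i) (?c (?b (?a e))) = ?c (theta i (?a e))"
      unfolding theta_mul_A by (rule mul_commute)
    have "mul (A i) (?c (?b (?a e))) \<in> S (n + 2)"
      unfolding eq by (rule S_cong[OF S_mul[OF S_theta[OF n(3)[OF abc'(3)] i] BC(2)]]) simp
    ultimately have "adm s' i (insert (C i) (insert (B i) (insert (A (sig i)) X))) (?c (?b (?a e)))"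
      by (intro admI[of _ _ "n + 3" _ _ "n + 2"]) auto
    thus ?thesis using abc' by (auto simp: insert_commute)
  qed
qed

text \<open>The reduction modulo \<open>t\<close> identifies the position above the top digit with
  digit 0, which allows a reading to continue around the cycle.\<close>

lemma adm_word:
  assumes "accepts ls s s'" "adm s ((i + length ls) mod t) X e" "i + length ls \<le> t"
    and "\<And>j. i \<le> j \<Longrightarrow> j < i + length ls \<Longrightarrow> X \<inter> dvars j = {}"
  shows "\<exists>e'. adm s' (i mod t) (X \<union> wvars i ls) e'"
  using assms
proof (induction ls arbitrary: i s')
  case (Cons l ls)
  then obtain m where m: "accepts ls s m" "l \<in> letters m s'" by auto
  have "adm s ((Suc i + length ls) mod t) X e" "Suc i + length ls \<le> t" using Cons.prems by simp_all
  then obtain e1 where "adm m (Suc i mod t) (X \<union> wvars (Suc i) ls) e1"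
    using Cons.IH[OF m(1), of "Suc i"] Cons.prems(4) by auto
  moreover have "Suc i mod t = sig i" by (simp add: sig_def)
  moreover have i: "i < t" using Cons.prems(3) by simp
  moreover have "wvars (Suc i) ls \<inter> dvars i = {}"
    using wvars_disjoint[of "Suc i" ls i] Cons.prems(3) by simp
  hence "(X \<union> wvars (Suc i) ls) \<inter> dvars i = {}" using Cons.prems(4)[of i] by auto
  ultimately obtain e' where "adm s' i (X \<union> wvars (Suc i) ls \<union> lvars i l) e'"
    using adm_step[OF _ i m(2)] by metis
  moreover have "X \<union> wvars (Suc i) ls \<union> lvars i l = X \<union> wvars i (l # ls)" by auto
  ultimately show ?case using i by auto
qed auto

definition unit :: "var set \<Rightarrow> 'a" where "unit = Ghat {} {}"

lemma unit_apply: "unit X = (if X = {} then 1 else 0)"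
proof -
  have "X = {} \<longleftrightarrow> as X = {} \<and> bs X = {} \<and> cs X = {}"
    using var_set_subset_iff[of X "{}"] by auto
  moreover have "lead_cond {} {} X \<longleftrightarrow> as X = {} \<and> bs X = {} \<and> cs X = {}"
    by (auto simp: lead_cond_def Let_def)
  ultimately show ?thesis by (simp add: unit_def Ghat_def)
qed

lemma adm_unit: "adm False k {} unit"
proof (rule admI)
  show "lead {} unit" by (simp add: lead_def unit_apply)
  show "unit \<in> S 0" unfolding S_def gens_def unit_def
    by (rule fv.span_base) (force intro: exI[of _ "{}"])
qed auto

text \<open>For a cyclic word in state \<open>True\<close> the reading starts at a digit where the state is forced:
  to the left of a letter without \<open>B\<close>, or at a letter with both \<open>B\<close> and \<open>C\<close>.\<close>

lemma good_lead:
  assumes "ls \<in> good_words t"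
  shows "\<exists>e n. e \<in> S n \<and> lead (wvars 0 ls) e"
proof -
  have len: "length ls = t" using assms by (simp add: good_words_def)
  consider (1) "accepts ls False False"
    | (2) a c where "accepts ls True True" "(a, False, c) \<in> set ls"
    | (3) a where "accepts ls True True" "(a, True, True) \<in> set ls" "\<forall>(a, b, c) \<in> set ls. b"
  proof (cases "accepts ls False False")
    case False
    then obtain a b c where abc: "accepts ls True True" "(a, b, c) \<in> set ls" "\<not> b \<or> c"
      using assms by (auto simp: good_words_def)
    show thesis
    proof (cases "\<forall>(a, b, c) \<in> set ls. b")
      case True
      hence "b" "c" using abc by auto
      thus thesis using that(3) abc True by simp
    next
      case False
      then obtain a' c' where "(a', False, c') \<in> set ls" by auto
      thus thesis using that(2) abc by blast
    qed
  qed (rule that(1))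
  thus ?thesis
  proof cases
    case 1
    have "adm False ((0 + length ls) mod t) {} unit" by (rule adm_unit)
    from adm_word[OF 1 this] have "\<exists>e. adm False (0 mod t) ({} \<union> wvars 0 ls) e"
      using len by simp
    thus ?thesis unfolding adm_def by auto
  next
    case 2
    obtain ls1 ls2 where ls: "ls = ls1 @ (a, False, c) # ls2" using 2(2) by (meson split_list)
    obtain m where m: "accepts ((a, False, c) # ls2) True m" "accepts ls1 m True"
      using 2(1) unfolding ls accepts_append by blast
    obtain m' where "(a, False, c) \<in> letters m' m" using m(1) by auto
    hence "\<not> m" by (cases m'; cases m) auto
    hence m': "accepts ((a, False, c) # ls2) True False" "accepts ls1 False True" using m by simp_all
    \<comment> \<open>The reading begins to the left of the letter without \<open>B\<close>, goes
      down to digit 0 and resumes at the top digit.\<close>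
    obtain e1 where e1: "adm True 0 (wvars 0 ls1) e1"
      using adm_word[OF m'(2) adm_unit, of 0] len unfolding ls by auto
    let ?i = "length ls1"
    have "wvars 0 ls1 \<inter> dvars j = {}" if "?i \<le> j" "j < ?i + length ((a, False, c) # ls2)" for j
      using wvars_disjoint[of 0 ls1 j] that len unfolding ls by simp
    moreover have "adm True ((?i + length ((a, False, c) # ls2)) mod t) (wvars 0 ls1) e1"
      using e1 len unfolding ls by simp
    ultimately obtain e2 where "adm False (?i mod t) (wvars 0 ls1 \<union> wvars ?i ((a, False, c) # ls2)) e2"
      using adm_word[OF m'(1), of ?i "wvars 0 ls1" e1] len unfolding ls by auto
    thus ?thesis unfolding adm_def ls wvars_append by auto
  next
    case 3
    obtain ls1 ls2 where ls: "ls = ls1 @ (a, True, True) # ls2" using 3(2) by (meson split_list)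
    have all: "accepts u True True" if "\<forall>(a, b, c) \<in> set u. b" for u
      using that by (induction u) auto
    have acc: "accepts ls1 True True" "accepts ls2 True True" using 3(3) unfolding ls by (force intro!: all)+
    let ?j = "length ls1"
    have j: "?j < t" "Suc ?j + length ls2 = t" using len by (auto simp: ls)
    have X0: "lvars ?j (False, True, True) \<subseteq> dvars ?j" by (rule lvars_dvars)
    \<comment> \<open>The first letter is read without its possible \<open>A\<close>: from the unit,
      \<open>bc\<close> leads to \<open>True\<close>, whereas \<open>abc\<close> would lead to
      \<open>False\<close>. A missing \<open>A (sig ?j)\<close> is supplied at the end, when the
      reading returns to \<open>sig ?j\<close> in state \<open>True\<close>.\<close>
    obtain e0 where e0: "adm True ?j (lvars ?j (False, True, True)) e0"
      using adm_step[OF adm_unit j(1), of "(False, True, True)" True] by auto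
    have "lvars ?j (False, True, True) \<inter> dvars j = {}" if "j < ?j" for j
      using X0 dvars_disjoint[of ?j j] that j(1) by auto
    then obtain e1 where e1: "adm True 0 (lvars ?j (False, True, True) \<union> wvars 0 ls1) e1"
      using adm_word[OF acc(1), of 0 "lvars ?j (False, True, True)" e0] e0 j(1)
      by (auto simp del: lvars.simps)
    let ?X1 = "lvars ?j (False, True, True) \<union> wvars 0 ls1"
    have "?X1 \<inter> dvars j = {}" if "Suc ?j \<le> j" "j < Suc ?j + length ls2" for j
      using X0 wvars_disjoint[of 0 ls1 j] dvars_disjoint[of ?j j] that j by auto
    then obtain e2 where "adm True (Suc ?j mod t) (?X1 \<union> wvars (Suc ?j) ls2) e2"
      using adm_word[OF acc(2), of "Suc ?j" ?X1 e1] e1 j by (auto simp del: lvars.simps)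
    then obtain n where e2: "lead (?X1 \<union> wvars (Suc ?j) ls2) e2" "e2 \<in> S n" "mul (A (sig ?j)) e2 \<in> S (n - 1)"
      unfolding adm_def sig_def by auto
    show ?thesis
    proof (cases a)
      case False
      hence "?X1 \<union> wvars (Suc ?j) ls2 = wvars 0 ls" unfolding ls wvars_append by auto
      thus ?thesis using e2 by auto
    next
      case True
      have "wvars (Suc ?j) ls2 \<inter> dvars ?j = {}" "wvars 0 ls1 \<inter> dvars ?j = {}"
        using wvars_disjoint[of 0 ls1 ?j] wvars_disjoint[of "Suc ?j" ls2 ?j] j by auto
      hence "A (sig ?j) \<notin> ?X1 \<union> wvars (Suc ?j) ls2" by (auto simp: dvars_def)
      hence "lead (insert (A (sig ?j)) (?X1 \<union> wvars (Suc ?j) ls2)) (mul (A (sig ?j)) e2)"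
        by (rule lead_mul[OF e2(1)])
      moreover have "insert (A (sig ?j)) (?X1 \<union> wvars (Suc ?j) ls2) = wvars 0 ls"
        using True unfolding ls wvars_append by auto
      ultimately show ?thesis using e2(3) by auto
    qed
  qed
qed

section \<open>Triangularity and the rank formula\<close>

lemma triangular_independent:
  fixes f :: "'i \<Rightarrow> 'b \<Rightarrow> 'a" and m :: "'i \<Rightarrow> int"
  assumes fin: "finite I" and add: "\<And>i g h. c i (g + h) = c i g + c i h"
    and scale: "\<And>i k g. c i (\<lambda>x. k * g x) = k * (c i g :: 'a)"
    and diag: "\<And>i. i \<in> I \<Longrightarrow> c i (f i) = 1"
    and tri: "\<And>i j. i \<in> I \<Longrightarrow> j \<in> I \<Longrightarrow> c i (f j) \<noteq> 0 \<Longrightarrow> i = j \<or> m j < m i"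
  shows "inj_on f I" "fv.independent (f ` I)"
proof -
  have c0: "c i 0 = 0" for i by (metis add add_0_left add_self)
  have csum: "c i (\<Sum>j\<in>J. (\<lambda>x. u j * f j x)) = (\<Sum>j\<in>J. u j * c i (f j))" for i J and u :: "'i \<Rightarrow> 'a"
  proof (induction J rule: infinite_finite_induct)
    case (insert j J)
    thus ?case by (simp only: sum.insert[OF insert.hyps] add scale)
  qed (simp_all only: sum.infinite sum.empty c0 not_False_eq_True)
  show inj: "inj_on f I"
  proof (rule inj_onI)
    fix i j assume ij: "i \<in> I" "j \<in> I" "f i = f j"
    hence "c i (f j) \<noteq> 0" "c j (f i) \<noteq> 0" using diag by (metis zero_neq_one)+
    thus "i = j" using tri[OF ij(1,2)] tri[OF ij(2,1)] by fastforce
  qed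
  show "fv.independent (f ` I)"
  proof (rule fv.independent_if_scalars_zero)
    fix u g assume *: "(\<Sum>x\<in>f ` I. (\<lambda>y. u x * x y)) = 0" "g \<in> f ` I"
    have sum0: "(\<Sum>j\<in>I. (\<lambda>x. u (f j) * f j x)) = 0" using *(1) by (simp add: sum.reindex[OF inj])
    have "u (f i) = 0" if "i \<in> I" for i
    proof (rule ccontr)
      assume "u (f i) \<noteq> 0"
      hence ne: "{i \<in> I. u (f i) \<noteq> 0} \<noteq> {}" using that by blast
      have fin': "finite {i \<in> I. u (f i) \<noteq> 0}" using fin by simp
      \<comment> \<open>In a minimal index of the relation, all other terms are invisible to the
        functional \<open>c k\<close>.\<close>
      obtain k where k: "k \<in> I" "u (f k) \<noteq> 0" "\<And>j. j \<in> I \<Longrightarrow> u (f j) \<noteq> 0 \<Longrightarrow> m k \<le> m j"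
        using ex_min_if_finite[of "m ` {i \<in> I. u (f i) \<noteq> 0}"] ne fin' by (auto simp: not_less)
      have "c k (\<Sum>j\<in>I. (\<lambda>x. u (f j) * f j x)) = (\<Sum>j\<in>I. u (f j) * c k (f j))" by (rule csum)
      hence "0 = (\<Sum>j\<in>I. u (f j) * c k (f j))" by (simp only: sum0 c0)
      also have "\<dots> = (\<Sum>j\<in>I. if j = k then u (f k) else 0)"
      proof (intro sum.cong refl)
        fix j assume "j \<in> I"
        thus "u (f j) * c k (f j) = (if j = k then u (f k) else 0)"
        proof (cases "j = k")
          case False
          have "u (f j) = 0 \<or> c k (f j) = 0"
            using tri[OF k(1) \<open>j \<in> I\<close>] k(3)[OF \<open>j \<in> I\<close>] False by (metis not_less)
          thus ?thesis using False by auto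
        qed (simp add: diag[OF k(1)])
      qed
      also have "\<dots> = u (f k)" using k(1) fin by simp
      finally show False using k(2) by simp
    qed
    thus "u g = 0" using *(2) by blast
  qed (use fin in simp)
qed

lemma rank_lower: "card (good_words t) \<le> rank_F2_M F"
proof -
  let ?X = "wvars 0"
  have "\<forall>ls \<in> good_words t. \<exists>e. \<exists>n. e \<in> S n \<and> lead (?X ls) e" using good_lead by blast
  then obtain e where e: "\<And>ls. ls \<in> good_words t \<Longrightarrow> \<exists>n. e ls \<in> S n \<and> lead (?X ls) (e ls)" by metis
  have e': "e ls \<in> S (defect (?X ls))" "?X ls \<subseteq> Var" "lead (?X ls) (e ls)" if "ls \<in> good_words t" for ls
  proof -
    obtain n where n: "e ls \<in> S n" "lead (?X ls) (e ls)" using e \<open>ls \<in> good_words t\<close> by blast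
    hence "e ls (?X ls) \<noteq> 0" by (simp add: lead_def)
    thus "e ls \<in> S (defect (?X ls))" "?X ls \<subseteq> Var" "lead (?X ls) (e ls)"
      using S_support[OF n(1)] n by auto
  qed
  have "\<forall>ls \<in> good_words t. \<exists>g. g \<in> fv.span (range line_fun) \<and>
      (\<forall>X \<subseteq> Var. defect X \<le> defect (?X ls) \<longrightarrow> coef X g = e ls X)"
    using S_lift[OF e'(1)] by blast
  then obtain g where g: "\<And>ls. ls \<in> good_words t \<Longrightarrow> g ls \<in> fv.span (range line_fun)"
    "\<And>ls X. ls \<in> good_words t \<Longrightarrow> X \<subseteq> Var \<Longrightarrow> defect X \<le> defect (?X ls) \<Longrightarrow> coef X (g ls) = e ls X"
    by metis
  \<comment> \<open>A lexicographic order: the defect increases first, then the number of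
    \<open>C\<close> variables decreases. The factor \<open>t + 1\<close> suffices because this
    number lies between 0 and \<open>t\<close>.\<close>
  define m where "m ls = defect (?X ls) * (int t + 1) - int (card (cs (?X ls)))" for ls
  have fin: "finite (good_words t)"
  proof -
    have "good_words t \<subseteq> accepted t False False \<union> accepted t True True" by (auto simp: good_words_def accepted_def)
    thus ?thesis by (rule finite_subset) (simp add: finite_accepted)
  qed
  have diag: "coef (?X ls) (g ls) = 1" if "ls \<in> good_words t" for ls
    using g(2)[OF that e'(2)[OF that]] e'(3)[OF that] by (simp add: lead_def)
  have tri: "ls = ls' \<or> m ls' < m ls"
    if ls: "ls \<in> good_words t" "ls' \<in> good_words t" "coef (?X ls) (g ls') \<noteq> 0" for ls ls'
  proof (cases "defect (?X ls) \<le> defect (?X ls')")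
    case True
    hence ne: "e ls' (?X ls) \<noteq> 0" using g(2)[OF ls(2) e'(2)[OF ls(1)]] ls(3) by simp
    hence d: "defect (?X ls) = defect (?X ls')" using S_support[OF e'(1)[OF ls(2)]] by blast
    have "?X ls = ?X ls' \<or> card (cs (?X ls)) < card (cs (?X ls'))"
      using e'(3)[OF ls(2)] ne by (auto simp: lead_def)
    thus ?thesis
    proof
      assume "?X ls = ?X ls'"
      moreover have "length ls = t" "length ls' = t" using ls by (simp_all add: good_words_def)
      ultimately show ?thesis using wvars_inj[of 0 ls ls'] by simp
    qed (simp add: m_def d)
  next
    case False
    have "cs (?X ls) \<subseteq> {..<t}" using e'(2)[OF ls(1)] by (auto simp: var_set_subset_iff as_bs_cs_Var)
    hence "card (cs (?X ls)) \<le> t" using card_mono[of "{..<t}"] by fastforce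
    moreover have "(defect (?X ls') + 1) * (int t + 1) \<le> defect (?X ls) * (int t + 1)"
      using False by (intro mult_right_mono) auto
    ultimately have "m ls' < m ls" unfolding m_def by (simp add: algebra_simps)
    thus ?thesis ..
  qed
  have "inj_on g (good_words t)" "fv.independent (g ` good_words t)"
    using triangular_independent[where c = "\<lambda>ls. coef (?X ls)" and f = g and m = m, OF fin coef_add coef_scale diag tri]
    by blast+
  moreover have "g ` good_words t \<subseteq> fv.span (range line_fun)" using g(1) by blast
  ultimately show ?thesis using rank_ge[of "g ` good_words t"] by (simp add: card_image)
qed

lemma rank_formula: "real (rank_F2_M F) =
    1 + ((1 + sqrt 17) / 2) ^ (2 * t) + ((1 - sqrt 17) / 2) ^ (2 * t) - 2 ^ (t + 1)"
proof -
  have "rank_F2_M F + 2 ^ t + (2 ^ t - 1) = paths t False False + paths t True True"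
    using rank_upper rank_lower card_good[of t] by linarith
  hence "rank_F2_M F + 2 ^ (t + 1) = paths t False False + paths t True True + 1"
  proof -
    have "(2::nat) ^ (t + 1) = 2 * 2 ^ t" "(2::nat) ^ t \<ge> 1" by simp_all
    thus "rank_F2_M F + 2 ^ t + (2 ^ t - 1) = paths t False False + paths t True True \<Longrightarrow>
      rank_F2_M F + 2 ^ (t + 1) = paths t False False + paths t True True + 1"
      by linarith
  qed
  hence "real (rank_F2_M F) + 2 ^ (t + 1) = real (paths t False False + paths t True True) + 1"
    by (metis of_nat_add of_nat_1 of_nat_numeral of_nat_power)
  thus ?thesis unfolding paths_trace by simp
qed

end

theorem theorem1:
  fixes t :: nat and F :: "'a::{finite, field} itself"
  assumes "t > 0" and "card (UNIV :: 'a set) = 2 ^ t"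
  shows "real (rank_F2_M F) =
    1 + ((1 + sqrt 17) / 2) ^ (2 * t) + ((1 - sqrt 17) / 2) ^ (2 * t) - 2 ^ (t + 1)"
proof -
  interpret char2_field t F using assms by unfold_locales
  show ?thesis by (rule rank_formula)
qed

end
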